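(* There exists a magic-faced hypercube of dimension $n$ for every integer $n\ge 0$. Moreover: (a) If $n$ is even, then the magic-faced hypercube of dimension $n$ is unique up to the action of a permutation group $G_n$ of the $2^n$ positions (so $G_n\subset S_{2^n}$) with $G_n\cong C_2^n\rtimes S_{n+1}$; that is, the magic-faced hypercubes of dimension $n$ form a single orbit of $G_n$. (b) If $n$ is odd, then any magic-faced hypercube of dimension $n$ has a distinguished coordinate direction $j\in\{1,\ldots,n\}$ such that every pair of numbers on a line in direction $j$ sums to $2^n+1$. For each $j\in\{1,\ldots,n\}$, the magic-faced hypercube of dimension $n$ and distinguished direction $j$ is unique up to the action of a permutation group $G_{n,j}$ of the $2^n$ positions (so $G_{n,j}\subset S_{2^n}$) with $G_{n,j}\cong (C_2^{n-1}\rtimes S_n)\times C_2$; that is, the magic-faced hypercubes of dimension $n$ and direction $j$ form a single orbit of $G_{n,j}$. Hence there are exactly $2^n(n+1)!$ magic-faced hypercubes of dimension $n$ when $n$ is even, and exactly $n\cdot 2^n\, n!$ when $n$ is odd.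
   Context: The positions of a $2\times 2\times\cdots\times 2$ ($n$-fold) grid are the elements of $\{0,1\}^n$. A magic-faced hypercube of dimension $n$ is a bijection $A:\{0,1\}^n\to\{1,\ldots,2^n\}$ such that every $2\times 2$ face (the four positions obtained by fixing $n-2$ coordinates and letting the other two vary) has the same sum of labels. (For $n\le 1$ there are no such faces and the condition is vacuous.) A line in direction $j$ is a pair of positions differing exactly in coordinate $j$. A permutation $g$ of the positions acts on labelings by permuting positions, $A\mapsto A\circ g^{-1}$. $C_2$ is the cyclic group of order $2$. In $C_2^{k}\rtimes S_{k+1}$, the group $C_2^k$ is identified with $\mathbb{F}_2^{k+1}/\langle e_0+\cdots+e_k\rangle$, where $e_0,\ldots,e_k$ is the standard basis, and $S_{k+1}$ acts by permuting $e_0,\ldots,e_k$ (here $k=n$ in (a) and $k=n-1$ in (b)). *)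

theory Defs
  imports "HOL-Algebra.Algebra" "HOL-Algebra.Elementary_Groups" "HOL-Algebra.Product_Groups"
begin

definition positions :: "nat \<Rightarrow> (nat \<Rightarrow> nat) set" where
  "positions n = ({1..n} \<rightarrow>\<^sub>E {0, 1})"

definition face :: "nat \<Rightarrow> nat \<Rightarrow> nat \<Rightarrow> (nat \<Rightarrow> nat) \<Rightarrow> (nat \<Rightarrow> nat) set" where
  "face n i k x = {y \<in> positions n. \<forall>l \<in> {1..n} - {i, k}. y l = x l}"

definition faces :: "nat \<Rightarrow> (nat \<Rightarrow> nat) set set" where
  "faces n = {face n i k x | i k x. i \<in> {1..n} \<and> k \<in> {1..n} \<and> i \<noteq> k \<and> x \<in> positions n}"

(* Extensionality makes a labeling determined by its values on the positions, so that
   labelings can be counted. *)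
definition labelings :: "nat \<Rightarrow> ((nat \<Rightarrow> nat) \<Rightarrow> nat) set" where
  "labelings n = {A \<in> extensional (positions n). bij_betw A (positions n) {1..2 ^ n}}"

definition magic_faced :: "nat \<Rightarrow> ((nat \<Rightarrow> nat) \<Rightarrow> nat) set" where
  "magic_faced n = {A \<in> labelings n. \<forall>F \<in> faces n. \<forall>F' \<in> faces n. sum A F = sum A F'}"

definition is_line :: "nat \<Rightarrow> nat \<Rightarrow> (nat \<Rightarrow> nat) \<Rightarrow> (nat \<Rightarrow> nat) \<Rightarrow> bool" where
  "is_line n j x y \<longleftrightarrow> x \<in> positions n \<and> y \<in> positions n \<and>
     (\<forall>i \<in> {1..n}. x i \<noteq> y i \<longleftrightarrow> i = j)"

definition distinguished_direction :: "nat \<Rightarrow> nat \<Rightarrow> ((nat \<Rightarrow> nat) \<Rightarrow> nat) \<Rightarrow> bool" where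
  "distinguished_direction n j A \<longleftrightarrow>
     (\<forall>x y. is_line n j x y \<longrightarrow> A x + A y = 2 ^ n + 1)"

(* The labeling A o g^{-1}, restricted to the positions. *)
definition position_action ::
  "nat \<Rightarrow> ((nat \<Rightarrow> nat) \<Rightarrow> (nat \<Rightarrow> nat)) \<Rightarrow> ((nat \<Rightarrow> nat) \<Rightarrow> nat) \<Rightarrow> (nat \<Rightarrow> nat) \<Rightarrow> nat" where
  "position_action n g A = compose (positions n) A (inv_into (positions n) g)"

(* A single orbit of G on all labelings; in particular M is nonempty and G-invariant. *)
definition single_orbit ::
  "nat \<Rightarrow> ((nat \<Rightarrow> nat) \<Rightarrow> (nat \<Rightarrow> nat)) set \<Rightarrow> ((nat \<Rightarrow> nat) \<Rightarrow> nat) set \<Rightarrow> bool" where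
  "single_orbit n G M \<longleftrightarrow>
     M \<in> orbits ((BijGroup (positions n))\<lparr>carrier := G\<rparr>) (labelings n) (position_action n)"

(* Intended for an action \<phi> of H on N by automorphisms. *)
definition semidirect_product ::
  "('a, 'c) monoid_scheme \<Rightarrow> ('b, 'd) monoid_scheme \<Rightarrow> ('b \<Rightarrow> 'a \<Rightarrow> 'a) \<Rightarrow> ('a \<times> 'b) monoid" where
  "semidirect_product N H \<phi> =
    \<lparr>carrier = carrier N \<times> carrier H,
     monoid.mult = (\<lambda>(a, h) (b, k). (a \<otimes>\<^bsub>N\<^esub> \<phi> h b, h \<otimes>\<^bsub>H\<^esub> k)),
     one = (\<one>\<^bsub>N\<^esub>, \<one>\<^bsub>H\<^esub>)\<rparr>"

abbreviation C2 :: "int monoid" where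
  "C2 \<equiv> integer_mod_group 2"

(* The additive group of vectors indexed by 0, ..., k over the field with two elements. *)
definition F2_vec :: "nat \<Rightarrow> (nat \<Rightarrow> int) monoid" where
  "F2_vec k = product_group {0..k} (\<lambda>_. C2)"

(* The group C_2^k, as the quotient of F2_vec k by the span of e_0 + ... + e_k, which is
   the all-ones vector. *)
definition F2_quot :: "nat \<Rightarrow> (nat \<Rightarrow> int) set monoid" where
  "F2_quot k = F2_vec k Mod generate (F2_vec k) {\<lambda>i \<in> {0..k}. 1}"

(* On vectors this sends e_i to e_(s i); on cosets it is taken elementwise. *)
definition permute_coset :: "nat \<Rightarrow> (nat \<Rightarrow> nat) \<Rightarrow> (nat \<Rightarrow> int) set \<Rightarrow> (nat \<Rightarrow> int) set" where
  "permute_coset k s K = (\<lambda>v. \<lambda>i \<in> {0..k}. v (inv_into {0..k} s i)) ` K"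

(* C_2^k \<rtimes> S_(k+1), with S_(k+1) the permutations of {0..k}. *)
definition C2_semidirect_Sym :: "nat \<Rightarrow> ((nat \<Rightarrow> int) set \<times> (nat \<Rightarrow> nat)) monoid" where
  "C2_semidirect_Sym k = semidirect_product (F2_quot k) (BijGroup {0..k}) (permute_coset k)"

end

theory Submission
  imports Defs "HOL-Library.Nat_Bijection"
begin

text \<open>Write a position as a sign vector \<open>x\<close> with entries \<open>x\<^sub>1, \<dots>, x\<^sub>n\<close>, put \<open>x\<^sub>0 = 1\<close>, and
  centre a labeling \<open>A\<close> to \<open>f = 2 A - (2\<^sup>n + 1)\<close>. Then \<open>A\<close> is magic-faced iff all face sums of
  \<open>f\<close> vanish, that is, iff \<open>f x = P x (b\<^sub>0 x\<^sub>0 + \<dots> + b\<^sub>n x\<^sub>n)\<close> with \<open>P x\<close> the product of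
  all signs. Since the values of \<open>f\<close> are symmetric about 0, the maximal signed sum of the \<open>b\<^sub>i\<close> is
  attained twice, so some \<open>b\<^sub>j\<close> is 0; the absolute values of the other coefficients have all of
  \<open>0, \<dots>, 2\<^sup>n - 1\<close> as subset sums and hence are \<open>1, 2, \<dots>, 2\<^sup>n\<^sup>-\<^sup>1\<close>. If \<open>n\<close> is odd then \<open>j \<noteq> 0\<close>,
  and \<open>j\<close> is the distinguished direction.

  The function \<open>P x (b\<^sub>0 x\<^sub>0 + \<dots> + b\<^sub>k x\<^sub>k)\<close> is invariant under global negation of the signs when
  \<open>k\<close> is even, so it lives on \<open>F\<^sub>2\<^sup>k\<^sup>+\<^sup>1\<close> modulo the all-ones vector, on which the affine group
  acts by permuting the coefficients and changing their signs. For even \<open>n\<close> this is applied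
  with \<open>k = n\<close>; for odd \<open>n\<close> one has \<open>f x = x\<^sub>j g\<close> with \<open>g\<close> such a function for \<open>k = n - 1\<close> in the
  remaining coordinates.\<close>

section \<open>Magic-faced labelings as twisted linear forms\<close>

definition sgn_vec :: "(nat \<Rightarrow> nat) \<Rightarrow> nat \<Rightarrow> real" where
  "sgn_vec x i = (if i = 0 then 1 else (-1) ^ x i)"

definition twisted :: "nat \<Rightarrow> (nat \<Rightarrow> real) \<Rightarrow> (nat \<Rightarrow> real) \<Rightarrow> real" where
  "twisted n b e = (\<Prod>i\<in>{0..n}. e i) * (\<Sum>i\<in>{0..n}. b i * e i)"

definition represents :: "nat \<Rightarrow> (nat \<Rightarrow> real) \<Rightarrow> ((nat \<Rightarrow> nat) \<Rightarrow> nat) \<Rightarrow> bool" where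
  "represents n b A \<longleftrightarrow>
     (\<forall>x\<in>positions n. 2 * real (A x) - (2 ^ n + 1) = twisted n b (sgn_vec x))"

definition flip :: "nat \<Rightarrow> (nat \<Rightarrow> nat) \<Rightarrow> nat \<Rightarrow> nat" where
  "flip i x = x(i := 1 - x i)"

lemma card_positions: "card (positions n) = 2 ^ n"
  by (simp add: positions_def card_PiE numeral_2_eq_2)

lemma positions_cases: "x \<in> positions n \<Longrightarrow> i \<in> {1..n} \<Longrightarrow> x i = 0 \<or> x i = 1"
  by (force simp: positions_def PiE_def Pi_def)

lemma positions_ext:
  assumes "x \<in> positions n" "y \<in> positions n" "\<And>i. i \<in> {1..n} \<Longrightarrow> x i = y i"
  shows "x = y"
  using PiE_ext[of x "{1..n}" "\<lambda>_. {0, 1}" y] assms by (simp add: positions_def)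

lemma flip_in_positions: "x \<in> positions n \<Longrightarrow> i \<in> {1..n} \<Longrightarrow> flip i x \<in> positions n"
  by (auto simp: positions_def flip_def PiE_def Pi_def extensional_def)

lemma flip_flip: "x \<in> positions n \<Longrightarrow> i \<in> {1..n} \<Longrightarrow> flip i (flip i x) = x"
  using positions_cases[of x n i] by (auto simp: flip_def)

lemma bij_betw_flip: "i \<in> {1..n} \<Longrightarrow> bij_betw (flip i) (positions n) (positions n)"
  by (rule bij_betw_byWitness[where f' = "flip i"]) (auto simp: flip_flip flip_in_positions)

lemma sgn_vec_flip:
  assumes "x \<in> positions n" "i \<in> {1..n}"
  shows "sgn_vec (flip i x) = (sgn_vec x)(i := - sgn_vec x i)"
  using positions_cases[OF assms] assms(2) by (auto simp: sgn_vec_def flip_def)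

lemma sgn_vec_0: "sgn_vec x 0 = 1"
  by (simp add: sgn_vec_def)

lemma sgn_vec_cases: "sgn_vec x i = 1 \<or> sgn_vec x i = -1"
  by (cases "even (x i)") (auto simp: sgn_vec_def)

lemma sgn_vec_eqD:
  assumes "x \<in> positions n" "y \<in> positions n" "\<And>i. i \<in> {0..n} \<Longrightarrow> sgn_vec x i = sgn_vec y i"
  shows "x = y"
proof (rule positions_ext[OF assms(1,2)])
  fix i assume i: "i \<in> {1..n}"
  show "x i = y i"
    using assms(3)[of i] positions_cases[OF assms(1) i] positions_cases[OF assms(2) i] i
    by (auto simp: sgn_vec_def)
qed

lemma sgn_vec_of_set:
  "i \<in> {0..n} \<Longrightarrow> sgn_vec (\<lambda>i\<in>{1..n}. if i \<in> S then 1 else 0) i = (if i \<noteq> 0 \<and> i \<in> S then -1 else 1)"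
  by (auto simp: sgn_vec_def)

section \<open>Products and sums of signs under negation of one entry\<close>

lemma prod_signs:
  fixes e :: "'a \<Rightarrow> real"
  assumes "\<And>i. i \<in> I \<Longrightarrow> e i = 1 \<or> e i = -1"
  shows "(\<Prod>i\<in>I. e i) = 1 \<or> (\<Prod>i\<in>I. e i) = -1"
  using assms by (induction I rule: infinite_finite_induct) (force+)

lemma prod_sgn_vec: "(\<Prod>i\<in>I. sgn_vec x i) = 1 \<or> (\<Prod>i\<in>I. sgn_vec x i) = -1"
  by (rule prod_signs) (rule sgn_vec_cases)

lemma prod_negate_one:
  fixes e :: "'a \<Rightarrow> real"
  assumes "finite I" "i \<in> I"
  shows "(\<Prod>l\<in>I. (e(i := - e i)) l) = - (\<Prod>l\<in>I. e l)"
proof -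
  have "(\<Prod>l\<in>I-{i}. (e(i := - e i)) l) = (\<Prod>l\<in>I-{i}. e l)"
    by (rule prod.cong) auto
  then show ?thesis
    using prod.remove[OF assms, of e] prod.remove[OF assms, of "e(i := - e i)"] by simp
qed

lemma sum_negate_one:
  fixes e b :: "'a \<Rightarrow> real"
  assumes "finite I" "i \<in> I"
  shows "(\<Sum>l\<in>I. b l * (e(i := - e i)) l) = (\<Sum>l\<in>I. b l * e l) - 2 * b i * e i"
proof -
  have "(\<Sum>l\<in>I-{i}. b l * (e(i := - e i)) l) = (\<Sum>l\<in>I-{i}. b l * e l)"
    by (rule sum.cong) auto
  then show ?thesis
    using sum.remove[OF assms, of "\<lambda>l. b l * e l"]
      sum.remove[OF assms, of "\<lambda>l. b l * (e(i := - e i)) l"] by simp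
qed

lemma twisted_negate_one:
  assumes "i \<in> {0..n}"
  shows "twisted n b (e(i := - e i)) =
    - (\<Prod>l\<in>{0..n}. e l) * ((\<Sum>l\<in>{0..n}. b l * e l) - 2 * b i * e i)"
  using prod_negate_one[OF _ assms, of e] sum_negate_one[OF _ assms, of b e]
  by (simp only: twisted_def finite_atLeastAtMost)

lemma twisted_distrib:
  "twisted n b e = (\<Sum>i\<in>{0..n}. b i * ((\<Prod>l\<in>{0..n}. e l) * e i))"
  by (simp add: twisted_def sum_distrib_left mult_ac)

section \<open>The two-dimensional faces and their sums\<close>

lemma face_eq:
  assumes x: "x \<in> positions n" and ik: "i \<in> {1..n}" "k \<in> {1..n}" "i \<noteq> k"
  shows "face n i k x = {x, flip i x, flip k x, flip i (flip k x)}"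
proof (intro equalityI subsetI)
  fix y assume y: "y \<in> face n i k x"
  then have y': "y \<in> positions n" and eq: "\<And>l. l \<in> {1..n} \<Longrightarrow> l \<noteq> i \<Longrightarrow> l \<noteq> k \<Longrightarrow> y l = x l"
    by (auto simp: face_def)
  \<comment> \<open>The one of the four points that agrees with \<open>y\<close> at \<open>i\<close>
    and \<open>k\<close>; at every other coordinate \<open>y\<close> agrees with \<open>x\<close>,
    as does each candidate.\<close>
  define z where "z = (if y i = x i then (if y k = x k then x else flip k x)
    else if y k = x k then flip i x else flip i (flip k x))"
  have "y = z"
  proof (rule positions_ext[OF y'])
    show "z \<in> positions n" using x ik by (simp add: z_def flip_in_positions)
    fix l assume l: "l \<in> {1..n}"
    show "y l = z l"
      using eq[OF l] positions_cases[OF x ik(1)] positions_cases[OF x ik(2)]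
        positions_cases[OF y' ik(1)] positions_cases[OF y' ik(2)] ik(3)
      by (auto simp: z_def flip_def)
  qed
  then show "y \<in> {x, flip i x, flip k x, flip i (flip k x)}"
    by (auto simp: z_def split: if_splits)
next
  fix y assume "y \<in> {x, flip i x, flip k x, flip i (flip k x)}"
  then show "y \<in> face n i k x"
    using x ik flip_in_positions[OF x] flip_in_positions[OF flip_in_positions[OF x ik(2)] ik(1)]
    by (auto simp: face_def) (auto simp: flip_def split: if_splits)
qed

text \<open>The pair of values at \<open>i\<close> and \<open>k\<close> tells the four points apart,
  so the sum over the set has four separate terms.\<close>

lemma sum_face:
  assumes x: "x \<in> positions n" and ik: "i \<in> {1..n}" "k \<in> {1..n}" "i \<noteq> k"
  shows "sum A (face n i k x) = A x + A (flip i x) + A (flip k x) + A (flip i (flip k x))"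
proof -
  have v: "flip i x i \<noteq> x i" "flip k x k \<noteq> x k" "flip i (flip k x) i \<noteq> x i"
    "flip i (flip k x) k \<noteq> x k" "flip i x k = x k" "flip k x i = x i"
    using positions_cases[OF x ik(1)] positions_cases[OF x ik(2)] ik(3) by (auto simp: flip_def)
  have "flip i x \<noteq> x" "flip k x \<noteq> x" "flip i (flip k x) \<noteq> x" "flip i x \<noteq> flip k x"
    "flip i (flip k x) \<noteq> flip i x" "flip i (flip k x) \<noteq> flip k x"
    using v by metis+
  then show ?thesis
    unfolding face_eq[OF assms] by (simp add: add.assoc eq_commute)
qed

lemma sum_labels:
  assumes "A \<in> labelings n"
  shows "2 * (\<Sum>x\<in>positions n. A x) = 2 ^ n * (2 ^ n + 1)"
proof -
  have "(\<Sum>x\<in>positions n. A x) = (\<Sum>m\<in>{1..2^n}. m)"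
    using assms by (auto simp: labelings_def intro: sum.reindex_bij_betw)
  also have "2 * \<dots> = 2 ^ n * (2 ^ n + 1)"
    using double_gauss_sum_from_Suc_0[of "2 ^ n", where 'a = nat] by simp
  finally show ?thesis .
qed

text \<open>Averaging over all base points: flips permute the positions, so the face sums in the
  directions \<open>i\<close>, \<open>k\<close> add up to four times the sum of all labels, which
  determines their common value.\<close>

lemma magic_face_sum:
  assumes A: "A \<in> magic_faced n" and x: "x \<in> positions n"
    and ik: "i \<in> {1..n}" "k \<in> {1..n}" "i \<noteq> k"
  shows "sum A (face n i k x) = 2 * (2 ^ n + 1)"
proof -
  have lab: "A \<in> labelings n" using A by (simp add: magic_faced_def)
  define c where "c = sum A (face n i k x)"
  have const: "sum A (face n i k y) = c" if "y \<in> positions n" for y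
    using A ik x that unfolding magic_faced_def faces_def c_def by blast
  have ri: "(\<Sum>y\<in>positions n. B (flip i y)) = (\<Sum>y\<in>positions n. B y)" for B :: "_ \<Rightarrow> nat"
    by (rule sum.reindex_bij_betw[OF bij_betw_flip[OF ik(1)]])
  have rk: "(\<Sum>y\<in>positions n. B (flip k y)) = (\<Sum>y\<in>positions n. B y)" for B :: "_ \<Rightarrow> nat"
    by (rule sum.reindex_bij_betw[OF bij_betw_flip[OF ik(2)]])
  have "2 ^ n * c = (\<Sum>y\<in>positions n. sum A (face n i k y))"
    by (simp add: const card_positions)
  also have "\<dots> = (\<Sum>y\<in>positions n. A y + A (flip i y) + A (flip k y) + A (flip i (flip k y)))"
    by (rule sum.cong[OF refl]) (rule sum_face[OF _ ik])
  also have "\<dots> = 4 * (\<Sum>y\<in>positions n. A y)"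
    using rk[of A] ri[of A] rk[of "\<lambda>y. A (flip i y)"] by (simp add: sum.distrib)
  also have "\<dots> = 2 ^ n * (2 * (2 ^ n + 1))"
    using sum_labels[OF lab] by simp
  finally have "c = 2 * (2 ^ n + 1)" by (simp only: mult_cancel1) simp
  then show ?thesis by (simp only: c_def)
qed

text \<open>Multiplying by the product of all signs turns vanishing face sums into vanishing
  mixed second differences, which force an affine function.\<close>

lemma affine_of_mixed_differences:
  fixes h :: "(nat \<Rightarrow> nat) \<Rightarrow> real"
  assumes diff: "\<And>x i k. x \<in> positions n \<Longrightarrow> i \<in> {1..n} \<Longrightarrow> k \<in> {1..n} \<Longrightarrow> i \<noteq> k \<Longrightarrow>
      h x + h (flip i (flip k x)) = h (flip i x) + h (flip k x)"
  shows "\<exists>c d. \<forall>x\<in>positions n. h x = c + (\<Sum>i\<in>{1..n}. real (x i) * d i)"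
proof -
  define o' :: "nat \<Rightarrow> nat" where "o' = (\<lambda>i\<in>{1..n}. 0)"
  have o: "o' \<in> positions n" by (auto simp: o'_def positions_def)
  define d where "d i = h (flip i o') - h o'" for i
  have "h x = h o' + (\<Sum>i\<in>{1..n}. real (x i) * d i)" if "x \<in> positions n" for x
    using that
  proof (induction "card {i\<in>{1..n}. x i = 1}" arbitrary: x rule: less_induct)
    case less
    note x = less.prems
    let ?s = "\<lambda>x. \<Sum>i\<in>{1..n}. real (x i) * d i"
    have drop: "card {l\<in>{1..n}. flip i y l = 1} < card {l\<in>{1..n}. y l = 1}"
      "?s y = ?s (flip i y) + d i"
      if "y \<in> positions n" "i \<in> {1..n}" "y i = 1" for y i
    proof -
      show "card {l\<in>{1..n}. flip i y l = 1} < card {l\<in>{1..n}. y l = 1}"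
        by (rule psubset_card_mono) (use that in \<open>auto simp: flip_def split: if_splits\<close>)
      have "(\<Sum>l\<in>{1..n}-{i}. real (flip i y l) * d l) = (\<Sum>l\<in>{1..n}-{i}. real (y l) * d l)"
        by (rule sum.cong) (auto simp: flip_def)
      then show "?s y = ?s (flip i y) + d i"
        using that sum.remove[OF _ that(2), of "\<lambda>l. real (y l) * d l"]
          sum.remove[OF _ that(2), of "\<lambda>l. real (flip i y l) * d l"]
        by (simp add: flip_def)
    qed
    \<comment> \<open>Induction on the number of ones. Weights 0 and 1 hold by the choice of
      \<open>d\<close>; for two ones at \<open>i\<close> and \<open>k\<close> the difference
      equation expresses \<open>h x\<close> through three points of smaller weight.\<close>
    consider "\<And>i. i \<in> {1..n} \<Longrightarrow> x i = 0"
      | i where "i \<in> {1..n}" "x i = 1" "\<And>k. k \<in> {1..n} \<Longrightarrow> k \<noteq> i \<Longrightarrow> x k = 0"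
      | i k where "i \<in> {1..n}" "k \<in> {1..n}" "i \<noteq> k" "x i = 1" "x k = 1"
      using positions_cases[OF x] by metis
    then show ?case
    proof cases
      case 1
      then have "x = o'" by (intro positions_ext[OF x o]) (auto simp: o'_def)
      then show ?thesis by (simp add: o'_def)
    next
      case 2
      have "flip i x = o'"
        by (rule positions_ext[OF flip_in_positions[OF x 2(1)] o])
          (use 2 in \<open>auto simp: o'_def flip_def\<close>)
      then have "x = flip i o'" using flip_flip[OF x 2(1)] by simp
      have "?s (flip i x) = 0" unfolding \<open>flip i x = o'\<close> by (simp add: o'_def)
      then show ?thesis
        using drop(2)[OF x 2(1,2)] \<open>x = flip i o'\<close> by (simp add: d_def)
    next
      case 3
      have xi: "flip i x \<in> positions n" and xk: "flip k x \<in> positions n"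
        using 3 x by (simp_all add: flip_in_positions)
      have xik: "flip i (flip k x) \<in> positions n" using 3 xk by (simp add: flip_in_positions)
      have ki: "flip k x i = 1" using 3 by (simp add: flip_def)
      note d1 = drop[OF x 3(1,4)] and d2 = drop[OF x 3(2,5)] and d3 = drop[OF xk 3(1) ki]
      have "h (flip i x) = h o' + ?s (flip i x)" "h (flip k x) = h o' + ?s (flip k x)"
        "h (flip i (flip k x)) = h o' + ?s (flip i (flip k x))"
        using less.hyps[OF _ xi] less.hyps[OF _ xk] less.hyps[OF _ xik] d1(1) d2(1) d3(1)
        by linarith+
      then show ?thesis
        using diff[OF x 3(1-3)] d1(2) d2(2) d3(2) by linarith
    qed
  qed
  then show ?thesis by blast
qed

lemma magic_represented:
  assumes A: "A \<in> magic_faced n"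
  shows "\<exists>b. represents n b A"
proof -
  define P where "P x = (\<Prod>l\<in>{0..n}. sgn_vec x l)" for x
  define f where "f x = 2 * real (A x) - (2 ^ n + 1)" for x
  have P2: "P x * (P x * r) = r" for x r
    using prod_sgn_vec[of x "{0..n}"] by (auto simp: P_def)
  have Pflip: "P (flip i x) = - P x" if "x \<in> positions n" "i \<in> {1..n}" for x i
    unfolding P_def sgn_vec_flip[OF that] by (rule prod_negate_one) (use that in auto)
  have "P x * f x + P (flip i (flip k x)) * f (flip i (flip k x)) =
      P (flip i x) * f (flip i x) + P (flip k x) * f (flip k x)"
    if "x \<in> positions n" "i \<in> {1..n}" "k \<in> {1..n}" "i \<noteq> k" for x i k
  proof -
    have "A x + A (flip i x) + A (flip k x) + A (flip i (flip k x)) = 2 * (2 ^ n + 1)"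
      using magic_face_sum[OF A that] sum_face[OF that, of A] by simp
    then have "real (A x + A (flip i x) + A (flip k x) + A (flip i (flip k x))) =
        real (2 * (2 ^ n + 1))"
      by (simp only:)
    then have "f x + f (flip i (flip k x)) = - (f (flip i x) + f (flip k x))"
      by (simp add: f_def)
    moreover have "P (flip i (flip k x)) = P x" "P (flip i x) = - P x" "P (flip k x) = - P x"
      using that by (simp_all add: Pflip flip_in_positions)
    ultimately show ?thesis by (metis add_uminus_conv_diff distrib_left minus_add_distrib minus_mult_commute)
  qed
  from affine_of_mixed_differences[OF this] obtain c d where
    cd: "\<And>x. x \<in> positions n \<Longrightarrow> P x * f x = c + (\<Sum>i\<in>{1..n}. real (x i) * d i)"
    by blast
  \<comment> \<open>Substituting \<open>x i = (1 - sgn_vec x i) / 2\<close> puts half of each slope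
    into the constant term and leaves minus the other half on the sign. Multiplying by
    \<open>P x\<close> once more, whose square is 1, then recovers \<open>f\<close>.\<close>
  define b where "b i = (if i = 0 then c + (\<Sum>i\<in>{1..n}. d i / 2) else - d i / 2)" for i
  have "f x = twisted n b (sgn_vec x)" if x: "x \<in> positions n" for x
  proof -
    have "(\<Sum>i\<in>{1..n}. real (x i) * d i) = (\<Sum>i\<in>{1..n}. d i / 2 + b i * sgn_vec x i)"
      by (rule sum.cong) (use positions_cases[OF x] in \<open>force simp: b_def sgn_vec_def\<close>)+
    then have "P x * f x = b 0 * sgn_vec x 0 + (\<Sum>i\<in>{1..n}. b i * sgn_vec x i)"
      using cd[OF x] by (simp only: sum.distrib) (simp add: b_def sgn_vec_0)
    also have "\<dots> = (\<Sum>i\<in>{0..n}. b i * sgn_vec x i)"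
      by (simp add: sum.atLeast_Suc_atMost)
    finally have "P x * (P x * f x) = P x * (\<Sum>i\<in>{0..n}. b i * sgn_vec x i)" by simp
    then show ?thesis by (simp add: P2) (simp add: twisted_def P_def)
  qed
  then show ?thesis by (auto simp: represents_def f_def)
qed

text \<open>Flipping one coordinate negates the product of signs and lowers the linear sum by twice
  one term; over the four points of a face these contributions cancel, so the centred face sum is
  0.\<close>

lemma represented_magic:
  assumes lab: "A \<in> labelings n" and b: "represents n b A"
  shows "A \<in> magic_faced n"
proof -
  have "sum A F = 2 * (2 ^ n + 1)" if F_face: "F \<in> faces n" for F
  proof -
    obtain i k x where F: "F = face n i k x" and ik: "i \<in> {1..n}" "k \<in> {1..n}" "i \<noteq> k"
      and x: "x \<in> positions n"
      using F_face unfolding faces_def by (elim CollectE exE conjE) (rule that)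
    define f where "f x = 2 * real (A x) - (2 ^ n + 1)" for x
    have f: "f y = twisted n b (sgn_vec y)" if "y \<in> positions n" for y
      using b that by (simp add: represents_def f_def)
    have ik0: "i \<in> {0..n}" "k \<in> {0..n}" using ik by auto
    have xk: "flip k x \<in> positions n" using x ik by (simp add: flip_in_positions)
    let ?P = "\<Prod>l\<in>{0..n}. sgn_vec x l" and ?T = "\<Sum>l\<in>{0..n}. b l * sgn_vec x l"
    have 1: "f (flip i x) = - ?P * (?T - 2 * b i * sgn_vec x i)"
      "f (flip k x) = - ?P * (?T - 2 * b k * sgn_vec x k)"
      using x ik by (simp_all only: f flip_in_positions sgn_vec_flip twisted_negate_one[OF ik0(1)]
          twisted_negate_one[OF ik0(2)])
    have 2: "f (flip i (flip k x)) = ?P * (?T - 2 * b k * sgn_vec x k - 2 * b i * sgn_vec x i)"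
      unfolding f[OF flip_in_positions[OF xk ik(1)]] sgn_vec_flip[OF xk ik(1)]
        twisted_negate_one[OF ik0(1)] sgn_vec_flip[OF x ik(2)]
        prod_negate_one[OF finite_atLeastAtMost ik0(2)] sum_negate_one[OF finite_atLeastAtMost ik0(2)]
      using ik(3) by simp
    have 3: "f x = ?P * ?T" using f[OF x] by (simp add: twisted_def)
    have "f x + f (flip i x) + f (flip k x) + f (flip i (flip k x)) = 0"
      unfolding 1 2 3 by (simp add: algebra_simps)
    then have "real (A x + A (flip i x) + A (flip k x) + A (flip i (flip k x))) =
        real (2 * (2 ^ n + 1))"
      by (simp add: f_def)
    then have "A x + A (flip i x) + A (flip k x) + A (flip i (flip k x)) = 2 * (2 ^ n + 1)"
      by (simp only: of_nat_eq_iff)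
    then show ?thesis unfolding F using sum_face[OF x ik, of A] by simp
  qed
  then show ?thesis using lab by (simp add: magic_faced_def)
qed

section \<open>Classification of the coefficients\<close>

text \<open>There are only \<open>2 ^ n\<close> subsets for the \<open>2 ^ n\<close> required
  values, so a subset is determined by its sum. The weights 1, 2, 4, ... are then forced one after
  the other.\<close>

lemma powers_of_subset_sums:
  fixes w :: "'a \<Rightarrow> real"
  assumes fin: "finite I" and card: "card I = n" and nonneg: "\<And>i. i \<in> I \<Longrightarrow> w i \<ge> 0"
    and surj: "\<And>m. m < 2 ^ n \<Longrightarrow> \<exists>T\<subseteq>I. sum w T = real m"
  shows "bij_betw w I ((\<lambda>r. 2 ^ r) ` {..<n})"
proof -
  have sub: "real ` {..<2 ^ n} \<subseteq> sum w ` Pow I"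
  proof
    fix r assume "r \<in> real ` {..<2 ^ n}"
    then obtain m where "m < 2 ^ n" "r = real m" by blast
    then show "r \<in> sum w ` Pow I" using surj[of m] by (metis PowI image_eqI)
  qed
  have "card (real ` {..<2 ^ n :: nat}) = 2 ^ n" by (simp add: card_image)
  then have "2 ^ n \<le> card (sum w ` Pow I)"
    using card_mono[OF _ sub] fin by simp
  then have inj: "inj_on (sum w) (Pow I)"
    using fin card card_image_le[of "Pow I" "sum w"]
    by (intro eq_card_imp_inj_on) (auto simp: card_Pow)
  \<comment> \<open>Invariant of the greedy construction: \<open>J\<close> holds the weights below
    \<open>2 ^ r\<close>, and its subset sums fill all naturals below \<open>2 ^ r\<close>.\<close>
  have "\<exists>J\<subseteq>I. bij_betw w J ((\<lambda>r. 2 ^ r) ` {..<r}) \<and> (\<forall>m<2 ^ r. \<exists>T\<subseteq>J. sum w T = real m)"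
    if "r \<le> n" for r
    using that
  proof (induction r)
    case 0
    then show ?case by (intro exI[of _ "{}"]) (auto simp: bij_betw_def)
  next
    case (Suc r)
    then obtain J where J: "J \<subseteq> I" "bij_betw w J ((\<lambda>r. 2 ^ r) ` {..<r})"
      and sums: "\<And>m. m < 2 ^ r \<Longrightarrow> \<exists>T\<subseteq>J. sum w T = real m"
      by auto
    have finJ: "finite J" using J(1) fin finite_subset by blast
    have "(2::nat) ^ r < 2 ^ n" using Suc.prems by simp
    then obtain T where T: "T \<subseteq> I" "sum w T = 2 ^ r" using surj[of "2 ^ r"] by auto
    have sumJ: "sum w J = 2 ^ r - 1"
    proof -
      have "sum w J = sum (\<lambda>x. x) ((\<lambda>r. 2 ^ r) ` {..<r} :: real set)"
        using sum.reindex_bij_betw[OF J(2), of "\<lambda>x. x"] by simp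
      also have "\<dots> = (\<Sum>t<r. 2 ^ t)"
        by (subst sum.reindex) (auto simp: inj_on_def)
      finally show ?thesis by (simp add: sum_gp_strict)
    qed
    \<comment> \<open>The total weight of \<open>J\<close> misses \<open>2 ^ r\<close> by one, so
      \<open>T\<close> must use an element outside \<open>J\<close>, and its weight is at most
      \<open>2 ^ r\<close>.\<close>
    have "\<not> T \<subseteq> J"
    proof
      assume "T \<subseteq> J"
      then have "sum w T \<le> sum w J"
        using J(1) nonneg finJ by (intro sum_mono2) auto
      then show False using T(2) sumJ by simp
    qed
    then obtain i where i: "i \<in> T" "i \<notin> J" by blast
    have iI: "i \<in> I" using i T by blast
    have "w i \<le> 2 ^ r"
      using member_le_sum[of i T w] i(1) T nonneg finite_subset[OF T(1) fin] by auto
    \<comment> \<open>A smaller weight would already be the sum of some subset of \<open>J\<close>,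
      which injectivity would identify with \<open>{i}\<close> although \<open>i\<close> is not in
      \<open>J\<close>.\<close>
    moreover have "\<not> w i < 2 ^ r"
    proof
      assume lt: "w i < 2 ^ r"
      \<comment> \<open>By injectivity there are exactly \<open>2 ^ n\<close> subset sums, so they
        are just the naturals below \<open>2 ^ n\<close>.\<close>
      have "w i \<in> \<nat>"
      proof -
        obtain m where "m < 2 ^ n" "w i = real m"
        proof -
          have "sum w ` Pow I = real ` {..<2 ^ n}"
          proof (rule card_subset_eq[OF _ sub, symmetric])
            show "finite (sum w ` Pow I)" using fin by simp
            show "card (real ` {..<2 ^ n}) = card (sum w ` Pow I)"
              using card_image[OF inj] fin card
              by (simp add: card_Pow card_image)
          qed
          moreover have "w i = sum w {i}" by simp
          ultimately have "w i \<in> real ` {..<2 ^ n}" using iI by blast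
          then show ?thesis using that by blast
        qed
        then show ?thesis by simp
      qed
      then obtain m where m: "w i = real m" by (auto simp: Nats_def)
      with lt have "real m < real (2 ^ r)" by simp
      then have "m < 2 ^ r" by (simp only: of_nat_less_iff)
      then obtain S where S: "S \<subseteq> J" "sum w S = w i" using sums m by metis
      have "S = {i}"
        by (rule inj_onD[OF inj]) (use S J(1) iI in auto)
      then show False using S i by blast
    qed
    ultimately have wi: "w i = 2 ^ r" by simp
    have "bij_betw w (J \<union> {i}) ((\<lambda>r. 2 ^ r) ` {..<r} \<union> {2 ^ r})"
      using wi i(2) J(2) by (intro bij_betw_combine) (auto simp: bij_betw_def)
    moreover have "(\<lambda>r. 2 ^ r :: real) ` {..<Suc r} = (\<lambda>r. 2 ^ r) ` {..<r} \<union> {2 ^ r}"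
      by (auto simp: lessThan_Suc)
    moreover have "\<exists>T\<subseteq>J \<union> {i}. sum w T = real m" if "m < 2 ^ Suc r" for m
    proof (cases "m < 2 ^ r")
      case True
      then obtain S where "S \<subseteq> J" "sum w S = real m" using sums[of m] by auto
      then show ?thesis by (intro exI[of _ S]) auto
    next
      case False
      then have "m - 2 ^ r < 2 ^ r" using that by simp
      then obtain S where S: "S \<subseteq> J" "sum w S = real (m - 2 ^ r)"
        using sums[of "m - 2 ^ r"] by auto
      then have "i \<notin> S" "finite S" using i(2) finite_subset[OF S(1) finJ] by auto
      then have "sum w (insert i S) = real m" using S(2) wi False by simp
      then show ?thesis using S(1) by (intro exI[of _ "insert i S"]) auto
    qed
    ultimately show ?case using J(1) iI by (intro exI[of _ "J \<union> {i}"]) auto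
  qed
  from this[of n] obtain J where J: "J \<subseteq> I" "bij_betw w J ((\<lambda>r. 2 ^ r) ` {..<n})"
    by auto
  have "card J = n"
    using bij_betw_same_card[OF J(2)] by (simp add: card_image inj_on_def)
  then have "J = I" using card_subset_eq[OF fin J(1)] card by simp
  then show ?thesis using J(2) by simp
qed

text \<open>The largest and the smallest label yield two different sign patterns with the same
  maximal signed sum; at an index where they differ the coefficient vanishes. With that index
  removed, \<open>powers_of_subset_sums\<close> applies to the absolute values.\<close>

lemma represents_classification:
  assumes lab: "A \<in> labelings n" and rep: "represents n b A"
  shows "\<exists>j\<in>{0..n}. b j = 0 \<and> (odd n \<longrightarrow> j \<noteq> 0) \<and>
    bij_betw (\<lambda>i. \<bar>b i\<bar>) ({0..n} - {j}) ((\<lambda>r. 2 ^ r) ` {..<n})"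
proof -
  define M :: real where "M = 2 ^ n - 1"
  define f where "f x = 2 * real (A x) - (2 ^ n + 1)" for x
  define P where "P x = (\<Prod>l\<in>{0..n}. sgn_vec x l)" for x
  have P: "P x = 1 \<or> P x = -1" for x unfolding P_def by (rule prod_sgn_vec)
  have bij: "bij_betw A (positions n) {1..2 ^ n}" using lab by (simp add: labelings_def)
  have f: "f x = (\<Sum>i\<in>{0..n}. b i * (P x * sgn_vec x i))" if "x \<in> positions n" for x
    using rep that unfolding represents_def f_def P_def twisted_distrib by blast
  have f_bound: "\<bar>f x\<bar> \<le> M" if "x \<in> positions n" for x
  proof -
    have "A x \<in> {1..2 ^ n}" using bij that by (auto simp: bij_betw_def)
    then have "1 \<le> A x" "A x \<le> 2 ^ n" by auto
    then have "real 1 \<le> real (A x)" "real (A x) \<le> real (2 ^ n)" by (simp_all only: of_nat_le_iff)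
    then show ?thesis unfolding f_def M_def by (simp only: of_nat_power of_nat_numeral)
  qed
  have bound: "(\<Sum>i\<in>{0..n}. b i * e i) \<le> M" if e: "\<And>i. e i = 1 \<or> e i = -1" for e :: "nat \<Rightarrow> real"
  proof -
    \<comment> \<open>A sign pattern is a position up to global sign: \<open>x\<close> is
      \<open>e\<close> normalised to sign 1 at index 0, and the factors \<open>e 0\<close> and
      \<open>P x\<close> change only the sign of the sum.\<close>
    define x :: "nat \<Rightarrow> nat" where
      "x = (\<lambda>i\<in>{1..n}. if i \<in> {i. e i \<noteq> e 0} then 1 else 0)"
    have x: "x \<in> positions n" by (auto simp: x_def positions_def)
    have "e 0 * P x * e i = P x * sgn_vec x i" if "i \<in> {0..n}" for i
      using e[of i] e[of 0] sgn_vec_of_set[OF that, of "{i. e i \<noteq> e 0}"]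
      by (auto simp: x_def)
    then have "f x = (\<Sum>i\<in>{0..n}. b i * (e 0 * P x * e i))"
      unfolding f[OF x] by (intro sum.cong refl) (simp only:)
    also have "\<dots> = (e 0 * P x) * (\<Sum>i\<in>{0..n}. b i * e i)"
      by (simp add: sum_distrib_left mult_ac)
    finally show ?thesis using f_bound[OF x] e[of 0] P[of x] by auto
  qed
  have "\<exists>x\<in>positions n. A x = m" if "m \<in> {1..2 ^ n}" for m
    using bij that unfolding bij_betw_def by (metis imageE)
  then obtain x1 x2 where x1: "x1 \<in> positions n" "A x1 = 2 ^ n"
    and x2: "x2 \<in> positions n" "A x2 = 1"
    by (metis atLeastAtMost_iff one_le_numeral one_le_power order_refl)
  define e1 where "e1 i = P x1 * sgn_vec x1 i" for i
  \<comment> \<open>The sign is reversed because label 1 gives the minimum \<open>- M\<close> of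
    \<open>f\<close>.\<close>
  define e2 where "e2 i = - (P x2 * sgn_vec x2 i)" for i
  have e1: "e1 i = 1 \<or> e1 i = -1" and e2: "e2 i = 1 \<or> e2 i = -1" for i
    using P[of x1] P[of x2] sgn_vec_cases[of x1 i] sgn_vec_cases[of x2 i]
    by (auto simp: e1_def e2_def)
  have s1: "(\<Sum>i\<in>{0..n}. b i * e1 i) = M"
    using f[OF x1(1)] x1(2) by (simp add: e1_def f_def M_def)
  have s2: "(\<Sum>i\<in>{0..n}. b i * e2 i) = M"
    using f[OF x2(1)] x2(2) by (simp add: e2_def f_def M_def sum_negf)
  \<comment> \<open>If the patterns agreed, index 0, whose sign is fixed to 1, would give
    \<open>P x1 = - P x2\<close>. Then all signs of \<open>x1\<close> and \<open>x2\<close> would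
    agree, hence also their products.\<close>
  have "\<exists>j\<in>{0..n}. e1 j \<noteq> e2 j"
  proof (rule ccontr)
    assume "\<not> ?thesis"
    then have eq: "P x1 * sgn_vec x1 i = - (P x2 * sgn_vec x2 i)" if "i \<in> {0..n}" for i
      using that by (auto simp: e1_def e2_def)
    then have neg: "P x1 = - P x2" using eq[of 0] by (simp add: sgn_vec_0)
    then have "sgn_vec x1 i = sgn_vec x2 i" if "i \<in> {0..n}" for i
      using eq[OF that] P[of x2] by auto
    then have "P x1 = P x2" unfolding P_def by (intro prod.cong refl)
    with neg P[of x1] show False by auto
  qed
  then obtain j where j: "j \<in> {0..n}" "e1 j \<noteq> e2 j" by blast
  \<comment> \<open>Reversing the sign at \<open>j\<close> cannot push a maximal sum beyond
    \<open>M\<close>. Applied to \<open>e1\<close> and \<open>e2\<close>, which are opposite at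
    \<open>j\<close>, this leaves only \<open>b j = 0\<close>.\<close>
  have nonneg: "b j * e j \<ge> 0" if e: "\<And>i. e i = 1 \<or> e i = -1" and s: "(\<Sum>i\<in>{0..n}. b i * e i) = M"
    for e :: "nat \<Rightarrow> real"
  proof -
    have "(\<Sum>i\<in>{0..n}. b i * (e(j := - e j)) i) \<le> M"
    proof (rule bound)
      show "(e(j := - e j)) i = 1 \<or> (e(j := - e j)) i = -1" for i
        using e[of i] by auto
    qed
    then show ?thesis
      using sum_negate_one[OF finite_atLeastAtMost j(1), of b e] s by simp
  qed
  have "b j * e1 j \<ge> 0" "b j * e2 j \<ge> 0" using nonneg e1 e2 s1 s2 by blast+
  then have bj: "b j = 0" using j(2) e1[of j] e2[of j] by auto
  let ?I = "{0..n} - {j}"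
  \<comment> \<open>Making every term nonnegative is itself a choice of signs, so the total absolute
    weight is the maximum \<open>M\<close>.\<close>
  have sum_abs: "(\<Sum>i\<in>?I. \<bar>b i\<bar>) = M"
  proof -
    have "(\<Sum>i\<in>{0..n}. \<bar>b i\<bar>) = (\<Sum>i\<in>{0..n}. b i * (if b i \<ge> 0 then 1 else -1))"
      by (rule sum.cong) auto
    also have "\<dots> \<le> M" by (rule bound) auto
    finally have "(\<Sum>i\<in>{0..n}. \<bar>b i\<bar>) \<le> M" .
    moreover have "b i * e1 i \<le> \<bar>b i\<bar>" for i using e1[of i] by auto
    then have "M \<le> (\<Sum>i\<in>{0..n}. \<bar>b i\<bar>)" unfolding s1[symmetric] by (intro sum_mono) auto
    ultimately show ?thesis using sum.remove[OF _ j(1), of "\<lambda>i. \<bar>b i\<bar>"] bj by simp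
  qed
  have "bij_betw (\<lambda>i. \<bar>b i\<bar>) ?I ((\<lambda>r. 2 ^ r) ` {..<n})"
  proof (rule powers_of_subset_sums)
    show "card ?I = n" using j(1) by simp
    fix m :: nat assume "m < 2 ^ n"
    then have "Suc m \<in> {1..2 ^ n}" by auto
    then obtain x where x: "x \<in> positions n" "A x = Suc m"
      using bij unfolding bij_betw_def by (metis imageE)
    \<comment> \<open>The terms counted positively: the signed sum is twice the weight of
      \<open>T\<close> minus \<open>M\<close>, so the label \<open>Suc m\<close> gives
      \<open>T\<close> the weight \<open>m\<close>.\<close>
    define T where "T = {i\<in>?I. b i * (P x * sgn_vec x i) \<ge> 0}"
    have "b i * (P x * sgn_vec x i) =
        2 * (if b i * (P x * sgn_vec x i) \<ge> 0 then \<bar>b i\<bar> else 0) - \<bar>b i\<bar>" for i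
      using P[of x] sgn_vec_cases[of x i] by auto
    then have "(\<Sum>i\<in>?I. b i * (P x * sgn_vec x i)) =
        (\<Sum>i\<in>?I. 2 * (if b i * (P x * sgn_vec x i) \<ge> 0 then \<bar>b i\<bar> else 0) - \<bar>b i\<bar>)"
      by (intro sum.cong refl)
    also have "\<dots> = 2 * (\<Sum>i\<in>?I. if b i * (P x * sgn_vec x i) \<ge> 0 then \<bar>b i\<bar> else 0) - M"
      by (simp only: sum_subtractf sum_abs sum_distrib_left)
    also have "(\<Sum>i\<in>?I. if b i * (P x * sgn_vec x i) \<ge> 0 then \<bar>b i\<bar> else 0) = (\<Sum>i\<in>T. \<bar>b i\<bar>)"
      unfolding T_def by (rule sum.inter_filter[symmetric]) simp
    finally have "f x = 2 * (\<Sum>i\<in>T. \<bar>b i\<bar>) - M"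
      using f[OF x(1)] sum.remove[OF _ j(1), of "\<lambda>i. b i * (P x * sgn_vec x i)"] bj by simp
    then have "(\<Sum>i\<in>T. \<bar>b i\<bar>) = real m" using x(2) by (simp add: f_def M_def)
    then show "\<exists>T\<subseteq>?I. (\<Sum>i\<in>T. \<bar>b i\<bar>) = real m" by (intro exI[of _ T]) (auto simp: T_def)
  qed auto
  \<comment> \<open>For odd \<open>n\<close> the patterns \<open>P x * sgn_vec x i\<close> of the
    all-zeros and the all-ones position differ at index 0 only. If \<open>b 0\<close> vanished, both
    would receive the same label.\<close>
  moreover have "j \<noteq> 0" if n: "odd n"
  proof
    assume j0: "j = 0"
    define x y :: "nat \<Rightarrow> nat" where "x = (\<lambda>i\<in>{1..n}. if i \<in> {} then 1 else 0)"
      and "y = (\<lambda>i\<in>{1..n}. if i \<in> {1..n} then 1 else 0)"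
    have xy: "x \<in> positions n" "y \<in> positions n"
      by (auto simp: x_def y_def positions_def)
    have sx: "sgn_vec x i = 1" if "i \<in> {0..n}" for i
      using sgn_vec_of_set[OF that, of "{}"] unfolding x_def by simp
    have sy: "sgn_vec y i = (if i = 0 then 1 else -1)" if "i \<in> {0..n}" for i
      using sgn_vec_of_set[OF that, of "{1..n}"] that by (auto simp: y_def)
    have Px: "P x = 1" by (simp add: P_def sx)
    have "P y = (\<Prod>l\<in>{1..n}. sgn_vec y l)"
      unfolding P_def using prod.atLeast_Suc_atMost[of 0 n "sgn_vec y"] by (simp add: sgn_vec_0)
    also have "\<dots> = (\<Prod>l\<in>{1..n}. -1)" by (rule prod.cong) (auto simp: sy)
    finally have Py: "P y = -1" using n by simp
    have "f x = f y" unfolding f[OF xy(1)] f[OF xy(2)] Px Py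
      by (rule sum.cong) (auto simp: sx sy bj[unfolded j0])
    then have "A x = A y" by (simp add: f_def)
    then have "x = y" using bij xy by (auto simp: bij_betw_def inj_on_def)
    moreover have "x 1 \<noteq> y 1" using n by (simp add: x_def y_def Suc_le_eq odd_pos)
    ultimately show False by simp
  qed
  ultimately show ?thesis using j(1) bj by blast
qed

section \<open>Explicit labelings for the admissible coefficients\<close>

text \<open>The normal form of the classification: the powers 1, 2, 4, ... in increasing order with
  a 0 inserted at index \<open>j\<close>.\<close>

definition base_coeffs :: "nat \<Rightarrow> nat \<Rightarrow> real" where
  "base_coeffs j i = (if i = j then 0 else 2 ^ (if i < j then i else i - 1))"

lemma bij_betw_skip:
  assumes "j \<le> n"
  shows "bij_betw (\<lambda>i::nat. if i < j then i else i - 1) ({0..n} - {j}) {..<n}"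
proof (rule bij_betw_byWitness[where f' = "\<lambda>i. if i < j then i else Suc i"])
qed (use assms in \<open>auto simp: image_subset_iff\<close>)

text \<open>The label minus one is a binary number whose digits tell which coefficients enter
  positively. The condition on \<open>j\<close> ensures that the sign pattern away from
  \<open>j\<close> still determines the position.\<close>

lemma base_labeling:
  assumes j: "j \<in> {0..n}" "odd n \<Longrightarrow> j \<noteq> 0"
  shows "\<exists>A\<in>labelings n. represents n (base_coeffs j) A"
proof -
  define P where "P x = (\<Prod>l\<in>{0..n}. sgn_vec x l)" for x
  have P: "P x = 1 \<or> P x = -1" for x unfolding P_def by (rule prod_sgn_vec)
  let ?I = "{0..n} - {j}" and ?t = "\<lambda>i. if i < j then i else i - 1"
  have tbij: "bij_betw ?t ?I {..<n}" using bij_betw_skip j(1) by simp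
  define T where "T x = {i\<in>?I. P x * sgn_vec x i = 1}" for x
  define A where "A = (\<lambda>x\<in>positions n. Suc (set_encode (?t ` T x)))"
  have T: "T x \<subseteq> ?I" for x by (auto simp: T_def)
  have injt: "inj_on ?t (T x)" for x
    by (rule inj_on_subset[OF bij_betw_imp_inj_on[OF tbij] T])
  have tT: "?t ` T x \<subseteq> {..<n}" for x
    using image_mono[OF T, of ?t] bij_betw_imp_surj_on[OF tbij] by (simp only:)
  have enc: "set_encode (?t ` T x) = (\<Sum>i\<in>T x. 2 ^ ?t i)" for x
    unfolding set_encode_def sum.reindex[OF injt] by (simp only: o_def)
  have "inj_on A (positions n)"
  proof (rule inj_onI)
    fix x y assume xy: "x \<in> positions n" "y \<in> positions n" and "A x = A y"
    then have "set_encode (?t ` T x) = set_encode (?t ` T y)" by (simp add: A_def)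
    then have "?t ` T x = ?t ` T y"
      using finite_subset[OF tT finite_lessThan] by (simp only: set_encode_eq)
    then have "T x = T y"
      using inj_on_image_eq_iff[OF bij_betw_imp_inj_on[OF tbij] T T] by (simp only:)
    then have eq: "P x * sgn_vec x i = P y * sgn_vec y i" if "i \<in> ?I" for i
    proof -
      have "i \<in> T x \<longleftrightarrow> i \<in> T y" using \<open>T x = T y\<close> by simp
      then have "P x * sgn_vec x i = 1 \<longleftrightarrow> P y * sgn_vec y i = 1"
        using that unfolding T_def by blast
      moreover have "P z * sgn_vec z i = 1 \<or> P z * sgn_vec z i = -1" for z
        using P[of z] sgn_vec_cases[of z i] by (elim disjE) simp_all
      ultimately show ?thesis by metis
    qed
    \<comment> \<open>If \<open>j\<close> is not 0, the pattern at index 0 is \<open>P\<close>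
      itself. If \<open>j = 0\<close>, then \<open>n\<close> is even and the product of the
      \<open>n\<close> pattern entries is \<open>P ^ n * P = P\<close>.\<close>
    have Peq: "P x = P y"
    proof (cases "j = 0")
      case False
      then show ?thesis using eq[of 0] by (simp add: sgn_vec_0)
    next
      case True
      have *: "P z = (\<Prod>l\<in>{1..n}. P z * sgn_vec z l)" for z
      proof -
        have "P z = (\<Prod>l\<in>{1..n}. sgn_vec z l)"
          unfolding P_def using prod.atLeast_Suc_atMost[of 0 n "sgn_vec z"] by (simp add: sgn_vec_0)
        moreover have "even n" using True j(2) by blast
        then have "P z ^ n = 1" using P[of z] by (elim disjE) simp_all
        ultimately show ?thesis
          by (simp only: prod.distrib prod_constant card_atLeastAtMost) simp
      qed
      have "(\<Prod>l\<in>{1..n}. P x * sgn_vec x l) = (\<Prod>l\<in>{1..n}. P y * sgn_vec y l)"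
        by (rule prod.cong) (auto simp: eq True)
      then show ?thesis by (rule trans[OF trans[OF *] *[symmetric]])
    qed
    then have eq': "sgn_vec x i = sgn_vec y i" if "i \<in> ?I" for i
      using eq[OF that] P[of y] by auto
    \<comment> \<open>The sign at \<open>j\<close> is recovered from the full product and the other
      signs.\<close>
    have "(\<Prod>l\<in>?I. sgn_vec x l) = (\<Prod>l\<in>?I. sgn_vec y l)"
      by (rule prod.cong) (auto simp: eq')
    moreover have "(\<Prod>l\<in>?I. sgn_vec x l) = 1 \<or> (\<Prod>l\<in>?I. sgn_vec x l) = -1"
      by (rule prod_sgn_vec)
    moreover have "P z = sgn_vec z j * (\<Prod>l\<in>?I. sgn_vec z l)" for z
      unfolding P_def by (rule prod.remove) (use j(1) in auto)
    ultimately have "sgn_vec x j = sgn_vec y j"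
      using Peq by (metis mult_cancel_right zero_neq_neg_one zero_neq_one)
    then show "x = y" using eq' by (intro sgn_vec_eqD[OF xy]) blast
  qed
  moreover have "A ` positions n \<subseteq> {1..2 ^ n}"
  proof clarify
    fix x assume "x \<in> positions n"
    have "set_encode (?t ` T x) \<le> set_encode {..<n}"
      unfolding set_encode_def by (rule sum_mono2) (use tT in auto)
    also have "\<dots> < 2 ^ n"
      unfolding set_encode_def using sum_power2[of n] by (simp add: atLeast0LessThan)
    finally show "A x \<in> {1..2 ^ n}" using \<open>x \<in> positions n\<close> by (simp add: A_def)
  qed
  ultimately have "bij_betw A (positions n) {1..2 ^ n}"
    unfolding bij_betw_def using card_subset_eq[of "{1..2 ^ n}" "A ` positions n"]
    by (simp add: card_image card_positions)
  then have "A \<in> labelings n" by (simp add: labelings_def A_def)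
  moreover have "2 * real (A x) - (2 ^ n + 1) = twisted n (base_coeffs j) (sgn_vec x)"
    if x: "x \<in> positions n" for x
  proof -
    have "(\<Sum>i\<in>?I. 2 ^ ?t i) = (\<Sum>r<n. 2 ^ r :: real)"
      by (rule sum.reindex_bij_betw[OF tbij])
    then have total: "(\<Sum>i\<in>?I. 2 ^ ?t i) = (2 ^ n - 1 :: real)"
      by (simp add: sum_gp_strict)
    have "twisted n (base_coeffs j) (sgn_vec x) =
        (\<Sum>i\<in>?I. base_coeffs j i * (P x * sgn_vec x i))"
      unfolding twisted_distrib P_def[symmetric]
      using sum.remove[OF _ j(1), of "\<lambda>i. base_coeffs j i * (P x * sgn_vec x i)"]
      by (simp add: base_coeffs_def)
    also have "\<dots> = (\<Sum>i\<in>?I. 2 * (if P x * sgn_vec x i = 1 then 2 ^ ?t i else 0) - 2 ^ ?t i)"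
    proof (rule sum.cong[OF refl])
      fix i assume "i \<in> ?I"
      then show "base_coeffs j i * (P x * sgn_vec x i) =
          2 * (if P x * sgn_vec x i = 1 then 2 ^ ?t i else 0) - 2 ^ ?t i"
        using P[of x] sgn_vec_cases[of x i] by (auto simp: base_coeffs_def)
    qed
    also have "\<dots> = 2 * (\<Sum>i\<in>?I. if P x * sgn_vec x i = 1 then 2 ^ ?t i else 0) - (2 ^ n - 1)"
      by (simp only: sum_subtractf total sum_distrib_left)
    also have "(\<Sum>i\<in>?I. if P x * sgn_vec x i = 1 then 2 ^ ?t i else 0) = (\<Sum>i\<in>T x. 2 ^ ?t i :: real)"
      unfolding T_def by (rule sum.inter_filter[symmetric]) simp
    also have "\<dots> = real (A x) - 1" unfolding A_def enc using x by simp
    finally show ?thesis by simp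
  qed
  ultimately show ?thesis unfolding represents_def by blast
qed

text \<open>Flipping \<open>j\<close> negates the product of signs, so the two centred labels on a
  line cancel except for the term of \<open>b j\<close>, which remains twice.\<close>

lemma distinguished_direction_iff:
  assumes rep: "represents n b A" and j: "j \<in> {1..n}"
  shows "distinguished_direction n j A \<longleftrightarrow> b j = 0"
proof -
  have j0: "j \<in> {0..n}" using j by simp
  have line: "A x + A (flip j x) = 2 ^ n + 1 \<longleftrightarrow> b j = 0" if x: "x \<in> positions n" for x
  proof -
    define f where "f x = 2 * real (A x) - (2 ^ n + 1)" for x
    let ?P = "\<Prod>l\<in>{0..n}. sgn_vec x l"
    have "f x = twisted n b (sgn_vec x)" "f (flip j x) = twisted n b (sgn_vec (flip j x))"
      using rep x j by (auto simp: f_def represents_def flip_in_positions)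
    then have "f x + f (flip j x) = 2 * ?P * b j * sgn_vec x j"
      unfolding sgn_vec_flip[OF x j] twisted_negate_one[OF j0]
      by (simp add: twisted_def algebra_simps)
    then have "f x + f (flip j x) = 0 \<longleftrightarrow> b j = 0"
      using prod_sgn_vec[of x "{0..n}"] sgn_vec_cases[of x j] by (elim disjE) simp_all
    moreover have "f x + f (flip j x) = 0 \<longleftrightarrow> real (A x + A (flip j x)) = real (2 ^ n + 1)"
      by (auto simp: f_def)
    ultimately show ?thesis by (simp only: of_nat_eq_iff)
  qed
  have "is_line n j x y \<longleftrightarrow> x \<in> positions n \<and> y = flip j x" for x y
  proof
    assume l: "is_line n j x y"
    then have xy: "x \<in> positions n" "y \<in> positions n" by (auto simp: is_line_def)
    have "y = flip j x"
    proof (rule positions_ext[OF xy(2) flip_in_positions[OF xy(1) j]])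
      fix i assume i: "i \<in> {1..n}"
      show "y i = flip j x i"
        using l i positions_cases[OF xy(1) i] positions_cases[OF xy(2) i]
        by (auto simp: is_line_def flip_def)
    qed
    then show "x \<in> positions n \<and> y = flip j x" using xy by simp
  next
    assume "x \<in> positions n \<and> y = flip j x"
    then show "is_line n j x y"
      using positions_cases[of x n] j flip_in_positions[of x n j]
      by (auto simp: is_line_def flip_def) force+
  qed
  \<comment> \<open>At least one line must exist for the direction to force
    \<open>b j = 0\<close>.\<close>
  moreover have "positions n \<noteq> {}" using card_positions[of n] by force
  ultimately show ?thesis using line by (auto simp: distinguished_direction_def)
qed

section \<open>Group actions and their orbits\<close>

text \<open>Turns a faithful action on a model \<open>Y\<close> of the positions into a group of
  position permutations. For each \<open>x\<close> exactly one \<open>y\<close> satisfies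
  \<open>\<theta> y = act h (\<theta> x)\<close>, so the description of \<open>M\<close> says that
  its members are \<open>A0\<close> precomposed with the permutations coming from
  \<open>H\<close>.\<close>

lemma orbit_of_transported_action:
  fixes H :: "('h, 'm) monoid_scheme" and act :: "'h \<Rightarrow> 'y \<Rightarrow> 'y"
  assumes H: "group H" and \<theta>: "bij_betw \<theta> (positions n) Y"
    and closed: "\<And>h y. h \<in> carrier H \<Longrightarrow> y \<in> Y \<Longrightarrow> act h y \<in> Y"
    and act_one: "\<And>y. y \<in> Y \<Longrightarrow> act \<one>\<^bsub>H\<^esub> y = y"
    and act_mult: "\<And>h k y. h \<in> carrier H \<Longrightarrow> k \<in> carrier H \<Longrightarrow> y \<in> Y \<Longrightarrow>
      act (h \<otimes>\<^bsub>H\<^esub> k) y = act h (act k y)"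
    and faithful: "\<And>h. h \<in> carrier H \<Longrightarrow> (\<And>y. y \<in> Y \<Longrightarrow> act h y = y) \<Longrightarrow> h = \<one>\<^bsub>H\<^esub>"
    and A0: "A0 \<in> labelings n"
    and M_sub: "M \<subseteq> labelings n"
    and M: "\<And>A. A \<in> labelings n \<Longrightarrow> A \<in> M \<longleftrightarrow> (\<exists>h\<in>carrier H. \<forall>x\<in>positions n. \<forall>y\<in>positions n.
      \<theta> y = act h (\<theta> x) \<longrightarrow> A x = A0 y)"
  shows "\<exists>G. subgroup G (BijGroup (positions n)) \<and> (BijGroup (positions n))\<lparr>carrier := G\<rparr> \<cong> H \<and>
      single_orbit n G M"
    and "card M = card (carrier H)"
proof -
  interpret H: group H by (rule H)
  let ?X = "positions n"
  define pull where "pull h x = inv_into ?X \<theta> (act h (\<theta> x))" for h x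
  define \<Phi> where "\<Phi> h = (\<lambda>x\<in>?X. pull h x)" for h
  have \<theta>Y: "\<theta> x \<in> Y" if "x \<in> ?X" for x using \<theta> that by (auto simp: bij_betw_def)
  have \<theta>_pull: "\<theta> (pull h x) = act h (\<theta> x)" if "h \<in> carrier H" "x \<in> ?X" for h x
    using bij_betw_inv_into_right[OF \<theta> closed[OF that(1) \<theta>Y[OF that(2)]]] by (simp add: pull_def)
  have pull_in: "pull h x \<in> ?X" if "h \<in> carrier H" "x \<in> ?X" for h x
    using bij_betwE[OF bij_betw_inv_into[OF \<theta>]] closed[OF that(1) \<theta>Y[OF that(2)]]
    by (simp add: pull_def)
  have \<theta>_inj: "x = y" if "x \<in> ?X" "y \<in> ?X" "\<theta> x = \<theta> y" for x y
    using bij_betw_imp_inj_on[OF \<theta>] that by (auto dest: inj_onD)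
  have pull_one: "pull \<one>\<^bsub>H\<^esub> x = x" if "x \<in> ?X" for x
    using that by (intro \<theta>_inj) (simp_all add: pull_in \<theta>_pull act_one \<theta>Y)
  have pull_mult: "pull (h \<otimes>\<^bsub>H\<^esub> k) x = pull h (pull k x)"
    if "h \<in> carrier H" "k \<in> carrier H" "x \<in> ?X" for h k x
    using that by (intro \<theta>_inj) (simp_all add: pull_in \<theta>_pull act_mult \<theta>Y)
  have pull_inv: "pull (inv\<^bsub>H\<^esub> h) (pull h x) = x" "pull h (pull (inv\<^bsub>H\<^esub> h) x) = x"
    if "h \<in> carrier H" "x \<in> ?X" for h x
    using that pull_mult[of "inv\<^bsub>H\<^esub> h" h x] pull_mult[of h "inv\<^bsub>H\<^esub> h" x]
    by (simp_all add: pull_one)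
  have pull_bij: "bij_betw (pull h) ?X ?X" if "h \<in> carrier H" for h
    by (rule bij_betw_byWitness[where f' = "pull (inv\<^bsub>H\<^esub> h)"])
      (use that in \<open>auto simp: pull_inv pull_in\<close>)
  have pull_faithful: "h = k"
    if hk: "h \<in> carrier H" "k \<in> carrier H" and eq: "\<And>x. x \<in> ?X \<Longrightarrow> pull h x = pull k x" for h k
  proof -
    have "act (inv\<^bsub>H\<^esub> k \<otimes>\<^bsub>H\<^esub> h) y = y" if "y \<in> Y" for y
    proof -
      obtain x where x: "x \<in> ?X" "y = \<theta> x" using \<theta> \<open>y \<in> Y\<close> unfolding bij_betw_def by blast
      have "act h y = act k y"
        using eq[OF x(1)] \<theta>_pull[OF hk(1) x(1)] \<theta>_pull[OF hk(2) x(1)] x(2) by simp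
      then show ?thesis
        using hk that act_mult[of "inv\<^bsub>H\<^esub> k" h y] act_mult[of "inv\<^bsub>H\<^esub> k" k y] by (simp add: act_one)
    qed
    then have "inv\<^bsub>H\<^esub> k \<otimes>\<^bsub>H\<^esub> h = \<one>\<^bsub>H\<^esub>" using hk by (intro faithful) auto
    then show ?thesis using hk by (metis H.inv_equality H.inv_inv H.inv_closed)
  qed
  have \<Phi>_bij: "\<Phi> h \<in> Bij ?X" if "h \<in> carrier H" for h
    using pull_bij[OF that] by (simp add: \<Phi>_def Bij_def bij_betw_restrict_eq)
  have \<Phi>_hom: "\<Phi> \<in> hom H (BijGroup ?X)"
  proof (rule homI)
    fix h k assume "h \<in> carrier H" "k \<in> carrier H"
    then show "\<Phi> (h \<otimes>\<^bsub>H\<^esub> k) = \<Phi> h \<otimes>\<^bsub>BijGroup ?X\<^esub> \<Phi> k"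
      by (auto simp: BijGroup_def \<Phi>_bij compose_def fun_eq_iff) (simp_all add: \<Phi>_def pull_mult pull_in)
  qed (simp add: BijGroup_def \<Phi>_bij)
  interpret \<Phi>: group_hom H "BijGroup ?X" \<Phi>
    by (intro group_hom.intro group_hom_axioms.intro H group_BijGroup \<Phi>_hom)
  have \<Phi>_inj: "inj_on \<Phi> (carrier H)"
  proof (rule inj_onI)
    fix h k assume hk: "h \<in> carrier H" "k \<in> carrier H" and "\<Phi> h = \<Phi> k"
    then have "pull h x = pull k x" if "x \<in> ?X" for x
      using fun_cong[OF \<open>\<Phi> h = \<Phi> k\<close>, of x] unfolding \<Phi>_def restrict_apply'[OF that] by blast
    then show "h = k" by (rule pull_faithful[OF hk])
  qed
  let ?G = "\<Phi> ` carrier H"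
  have "H \<cong> (BijGroup ?X)\<lparr>carrier := ?G\<rparr>"
    using \<Phi>_hom \<Phi>_inj by (intro is_isoI[of \<Phi>]) (simp add: iso_def hom_def bij_betw_def)
  then have iso: "(BijGroup ?X)\<lparr>carrier := ?G\<rparr> \<cong> H" by (rule H.iso_sym)
  \<comment> \<open>The labeling \<open>A0\<close> precomposed with \<open>pull h\<close>; these
    labelings make up \<open>M\<close>.\<close>
  define B where "B h = (\<lambda>x\<in>?X. A0 (pull h x))" for h
  have A0_bij: "bij_betw A0 ?X {1..2 ^ n}" using A0 by (simp add: labelings_def)
  have B_lab: "B h \<in> labelings n" if "h \<in> carrier H" for h
    using bij_betw_trans[OF pull_bij[OF that] A0_bij]
    by (simp add: labelings_def B_def bij_betw_restrict_eq o_def)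
  have M_eq: "M = B ` carrier H"
  proof (intro equalityI subsetI)
    fix A assume "A \<in> M"
    then have A: "A \<in> labelings n" using M_sub by (rule subsetD[rotated])
    with \<open>A \<in> M\<close> obtain h where h: "h \<in> carrier H"
      and eq: "\<And>x y. x \<in> ?X \<Longrightarrow> y \<in> ?X \<Longrightarrow> \<theta> y = act h (\<theta> x) \<Longrightarrow> A x = A0 y"
      unfolding M[OF A] by (elim bexE) simp
    have "A = B h"
    proof
      fix x show "A x = B h x"
        using A eq[of x "pull h x"] h
        by (cases "x \<in> ?X") (auto simp: B_def pull_in \<theta>_pull labelings_def extensional_def)
    qed
    then show "A \<in> B ` carrier H" using h by blast
  next
    fix A assume "A \<in> B ` carrier H"
    then obtain h where h: "h \<in> carrier H" and A: "A = B h" by blast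
    have "y = pull h x" if "x \<in> ?X" "y \<in> ?X" "\<theta> y = act h (\<theta> x)" for x y
      using that h by (intro \<theta>_inj) (simp_all add: pull_in \<theta>_pull)
    then show "A \<in> M" using h unfolding A M[OF B_lab[OF h]] by (auto simp: B_def)
  qed
  \<comment> \<open>The action on labelings uses the inverse permutation, so \<open>h\<close>
    produces \<open>B\<close> at the inverse of \<open>h\<close>. Inversion permutes
    \<open>H\<close>, hence the orbit is still the whole image of \<open>B\<close>.\<close>
  have pos: "position_action n (\<Phi> h) A0 = B (inv\<^bsub>H\<^esub> h)" if h: "h \<in> carrier H" for h
  proof
    fix x
    have "inv_into ?X (\<Phi> h) x = pull (inv\<^bsub>H\<^esub> h) x" if "x \<in> ?X"
      by (rule inv_into_f_eq)
        (use that h \<Phi>_bij[OF h] in \<open>auto simp: Bij_def bij_betw_def pull_in \<Phi>_def pull_inv\<close>)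
    then show "position_action n (\<Phi> h) A0 x = B (inv\<^bsub>H\<^esub> h) x"
      by (simp add: position_action_def compose_def B_def)
  qed
  have "M = orbit ((BijGroup ?X)\<lparr>carrier := ?G\<rparr>) (position_action n) A0"
  proof (intro equalityI subsetI)
    fix A assume "A \<in> M"
    then obtain h where h: "h \<in> carrier H" and "A = B h" using M_eq by blast
    then have "A = position_action n (\<Phi> (inv\<^bsub>H\<^esub> h)) A0" using pos[of "inv\<^bsub>H\<^esub> h"] by simp
    moreover have "\<Phi> (inv\<^bsub>H\<^esub> h) \<in> ?G" using h by blast
    ultimately obtain g where "g \<in> ?G" "A = position_action n g A0" by blast
    then show "A \<in> orbit ((BijGroup ?X)\<lparr>carrier := ?G\<rparr>) (position_action n) A0"
      unfolding orbit_def by auto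
  next
    fix A assume "A \<in> orbit ((BijGroup ?X)\<lparr>carrier := ?G\<rparr>) (position_action n) A0"
    then obtain h where "h \<in> carrier H" "A = position_action n (\<Phi> h) A0"
      unfolding orbit_def by auto
    then show "A \<in> M" using pos M_eq by auto
  qed
  then have "single_orbit n ?G M"
    unfolding single_orbit_def orbits_def using A0 by blast
  then show "\<exists>G. subgroup G (BijGroup ?X) \<and> (BijGroup ?X)\<lparr>carrier := G\<rparr> \<cong> H \<and> single_orbit n G M"
    using \<Phi>.img_is_subgroup iso by blast
  \<comment> \<open>Since \<open>A0\<close> is injective, its stabilizer is trivial and the orbit is
    as large as the group.\<close>
  have "inj_on B (carrier H)"
  proof (rule inj_onI)
    fix h k assume hk: "h \<in> carrier H" "k \<in> carrier H" and eq: "B h = B k"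
    have "pull h x = pull k x" if x: "x \<in> ?X" for x
      using fun_cong[OF eq, of x] x hk
      by (intro inj_onD[OF bij_betw_imp_inj_on[OF A0_bij]]) (simp_all add: B_def pull_in)
    then show "h = k" by (rule pull_faithful[OF hk])
  qed
  then show "card M = card (carrier H)" unfolding M_eq by (rule card_image)
qed

text \<open>The laws for \<phi> under which \<open>semidirect_product\<close>, which accepts any
  map, is a group.\<close>

locale group_acting_by_automorphisms = N: group N + H: group H
  for N :: "('a, 'c) monoid_scheme" and H :: "('b, 'd) monoid_scheme"
  and \<phi> :: "'b \<Rightarrow> 'a \<Rightarrow> 'a" +
  assumes act_closed: "h \<in> carrier H \<Longrightarrow> a \<in> carrier N \<Longrightarrow> \<phi> h a \<in> carrier N"
    and act_add: "h \<in> carrier H \<Longrightarrow> a \<in> carrier N \<Longrightarrow> b \<in> carrier N \<Longrightarrow>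
      \<phi> h (a \<otimes>\<^bsub>N\<^esub> b) = \<phi> h a \<otimes>\<^bsub>N\<^esub> \<phi> h b"
    and act_one: "a \<in> carrier N \<Longrightarrow> \<phi> \<one>\<^bsub>H\<^esub> a = a"
    and act_mult: "h \<in> carrier H \<Longrightarrow> k \<in> carrier H \<Longrightarrow> a \<in> carrier N \<Longrightarrow>
      \<phi> (h \<otimes>\<^bsub>H\<^esub> k) a = \<phi> h (\<phi> k a)"
begin

lemma act_zero: "h \<in> carrier H \<Longrightarrow> \<phi> h \<one>\<^bsub>N\<^esub> = \<one>\<^bsub>N\<^esub>"
  using act_add[of h "\<one>\<^bsub>N\<^esub>" "\<one>\<^bsub>N\<^esub>"] act_closed[of h "\<one>\<^bsub>N\<^esub>"] by simp

lemma group_semidirect_product: "group (semidirect_product N H \<phi>)"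
proof (rule groupI)
  fix x assume "x \<in> carrier (semidirect_product N H \<phi>)"
  then obtain a h where x: "x = (a, h)" and a: "a \<in> carrier N" and h: "h \<in> carrier H"
    by (auto simp: semidirect_product_def)
  let ?h = "inv\<^bsub>H\<^esub> h"
  \<comment> \<open>The computation behind the left inverse of \<open>(a, h)\<close>, whose first
    entry is the inverse of \<open>a\<close> moved by the inverse of \<open>h\<close>.\<close>
  have "\<phi> ?h (inv\<^bsub>N\<^esub> a) \<otimes>\<^bsub>N\<^esub> \<phi> ?h a = \<one>\<^bsub>N\<^esub>"
    using a h act_add[of ?h "inv\<^bsub>N\<^esub> a" a] by (simp add: act_zero)
  then show "\<exists>y\<in>carrier (semidirect_product N H \<phi>).
      y \<otimes>\<^bsub>semidirect_product N H \<phi>\<^esub> x = \<one>\<^bsub>semidirect_product N H \<phi>\<^esub>"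
    using a h by (intro bexI[of _ "(\<phi> ?h (inv\<^bsub>N\<^esub> a), ?h)"])
      (auto simp: semidirect_product_def x act_closed)
qed (auto simp: semidirect_product_def act_closed act_add act_mult act_one act_zero
    N.m_assoc H.m_assoc)

end

section \<open>The affine action on vectors modulo the all-ones vector\<close>

lemma F2_vec_carrier_iff:
  "v \<in> carrier (F2_vec k) \<longleftrightarrow> v \<in> extensional {0..k} \<and> (\<forall>i\<in>{0..k}. v i = 0 \<or> v i = 1)"
proof -
  have "{0..<2::int} = {0, 1}" by auto
  then show ?thesis
    by (auto simp: F2_vec_def carrier_integer_mod_group PiE_def Pi_def)
qed

lemma F2_vec_cases: "v \<in> carrier (F2_vec k) \<Longrightarrow> i \<in> {0..k} \<Longrightarrow> v i = 0 \<or> v i = 1"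
  by (simp add: F2_vec_carrier_iff)

lemma F2_vec_ext:
  assumes "v \<in> carrier (F2_vec k)" "w \<in> carrier (F2_vec k)"
    and "\<And>i. i \<in> {0..k} \<Longrightarrow> v i = w i"
  shows "v = w"
  using assms by (intro extensionalityI[of v "{0..k}" w]) (auto simp: F2_vec_carrier_iff)

lemma F2_vec_mult: "v \<otimes>\<^bsub>F2_vec k\<^esub> w = (\<lambda>i\<in>{0..k}. (v i + w i) mod 2)"
  by (simp add: F2_vec_def)

lemma F2_vec_one: "\<one>\<^bsub>F2_vec k\<^esub> = (\<lambda>i\<in>{0..k}. 0)"
  by (simp add: F2_vec_def)

lemma comm_group_F2_vec: "comm_group (F2_vec k)"
proof (rule group.group_comm_groupI)
  show "group (F2_vec k)" unfolding F2_vec_def by (rule product_group) simp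
qed (simp add: F2_vec_mult add.commute)

interpretation F2_vec: comm_group "F2_vec k" for k
  by (rule comm_group_F2_vec)

definition all_ones :: "nat \<Rightarrow> nat \<Rightarrow> int" where
  "all_ones k = (\<lambda>i\<in>{0..k}. 1)"

definition f2_coset :: "nat \<Rightarrow> (nat \<Rightarrow> int) \<Rightarrow> (nat \<Rightarrow> int) set" where
  "f2_coset k v = generate (F2_vec k) {all_ones k} #>\<^bsub>F2_vec k\<^esub> v"

definition f2_permute :: "nat \<Rightarrow> (nat \<Rightarrow> nat) \<Rightarrow> (nat \<Rightarrow> int) \<Rightarrow> nat \<Rightarrow> int" where
  "f2_permute k s v = (\<lambda>i\<in>{0..k}. v (inv_into {0..k} s i))"

lemma all_ones_in: "all_ones k \<in> carrier (F2_vec k)"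
  by (simp add: F2_vec_carrier_iff all_ones_def)

lemma add_all_ones:
  "v \<in> carrier (F2_vec k) \<Longrightarrow> i \<in> {0..k} \<Longrightarrow> (all_ones k \<otimes>\<^bsub>F2_vec k\<^esub> v) i = 1 - v i"
  using F2_vec_cases[of v k i] by (auto simp: F2_vec_mult all_ones_def)

lemma double_all_ones: "all_ones k \<otimes>\<^bsub>F2_vec k\<^esub> all_ones k = \<one>\<^bsub>F2_vec k\<^esub>"
  by (auto simp: F2_vec_mult F2_vec_one all_ones_def)

lemma generate_all_ones: "generate (F2_vec k) {all_ones k} = {\<one>\<^bsub>F2_vec k\<^esub>, all_ones k}"
proof (rule sym, rule F2_vec.generateI)
  have inv: "inv\<^bsub>F2_vec k\<^esub> all_ones k = all_ones k"
    by (rule F2_vec.inv_equality) (simp_all add: double_all_ones all_ones_in)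
  show "subgroup {\<one>\<^bsub>F2_vec k\<^esub>, all_ones k} (F2_vec k)"
    by (rule F2_vec.subgroupI) (auto simp: all_ones_in double_all_ones inv)
  fix K assume "subgroup K (F2_vec k)" "{all_ones k} \<subseteq> K"
  then show "{\<one>\<^bsub>F2_vec k\<^esub>, all_ones k} \<subseteq> K" by (simp add: subgroup.one_closed)
qed simp

lemma normal_all_ones: "generate (F2_vec k) {all_ones k} \<lhd> F2_vec k"
  unfolding F2_vec.normal_iff_subgroup
  by (rule F2_vec.generate_is_subgroup) (simp add: all_ones_in)

lemma F2_quot_eq: "F2_quot k = F2_vec k Mod generate (F2_vec k) {all_ones k}"
  by (simp add: F2_quot_def all_ones_def)

lemma group_F2_quot: "group (F2_quot k)"
  unfolding F2_quot_eq by (rule normal.factorgroup_is_group[OF normal_all_ones])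

lemma F2_quot_carrier: "carrier (F2_quot k) = f2_coset k ` carrier (F2_vec k)"
  by (auto simp: F2_quot_eq FactGroup_def RCOSETS_def f2_coset_def)

lemma f2_coset_in: "v \<in> carrier (F2_vec k) \<Longrightarrow> f2_coset k v \<in> carrier (F2_quot k)"
  by (simp add: F2_quot_carrier)

lemma F2_quot_mult:
  "v \<in> carrier (F2_vec k) \<Longrightarrow> w \<in> carrier (F2_vec k) \<Longrightarrow>
    f2_coset k v \<otimes>\<^bsub>F2_quot k\<^esub> f2_coset k w = f2_coset k (v \<otimes>\<^bsub>F2_vec k\<^esub> w)"
  by (simp add: F2_quot_eq FactGroup_def f2_coset_def normal.rcos_sum[OF normal_all_ones])

text \<open>The all-ones vector has order 2, so a class consists of a vector and its
  complement.\<close>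

lemma f2_coset_eq:
  "v \<in> carrier (F2_vec k) \<Longrightarrow> f2_coset k v = {v, all_ones k \<otimes>\<^bsub>F2_vec k\<^esub> v}"
  by (simp add: f2_coset_def r_coset_def generate_all_ones insert_commute)

lemma f2_coset_eq_iff:
  assumes "v \<in> carrier (F2_vec k)" "w \<in> carrier (F2_vec k)"
  shows "f2_coset k v = f2_coset k w \<longleftrightarrow> w = v \<or> w = all_ones k \<otimes>\<^bsub>F2_vec k\<^esub> v"
proof
  assume "f2_coset k v = f2_coset k w"
  then show "w = v \<or> w = all_ones k \<otimes>\<^bsub>F2_vec k\<^esub> v"
    using assms f2_coset_eq by blast
next
  have "all_ones k \<otimes>\<^bsub>F2_vec k\<^esub> (all_ones k \<otimes>\<^bsub>F2_vec k\<^esub> v) = v"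
    using assms all_ones_in by (simp add: F2_vec.m_assoc[symmetric] double_all_ones)
  moreover assume "w = v \<or> w = all_ones k \<otimes>\<^bsub>F2_vec k\<^esub> v"
  ultimately show "f2_coset k v = f2_coset k w"
    using assms by (auto simp: f2_coset_eq)
qed

lemma BijGroup_carrier: "carrier (BijGroup S) = Bij S"
  by (simp add: BijGroup_def)

lemma Bij_inv_in:
  assumes "s \<in> Bij S" "i \<in> S"
  shows "inv_into S s i \<in> S" "s (inv_into S s i) = i"
  using assms bij_betw_inv_into_right[of s S S i] Bij_inv_into_mem[OF assms] by (auto simp: Bij_def)

section \<open>Coordinate permutations on vectors and on classes\<close>

lemma f2_permute_in:
  "s \<in> Bij {0..k} \<Longrightarrow> v \<in> carrier (F2_vec k) \<Longrightarrow> f2_permute k s v \<in> carrier (F2_vec k)"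
  using Bij_inv_in(1)[of s "{0..k}"] by (simp add: F2_vec_carrier_iff f2_permute_def)

lemma f2_permute_add:
  assumes "s \<in> Bij {0..k}"
  shows "f2_permute k s (v \<otimes>\<^bsub>F2_vec k\<^esub> w) = f2_permute k s v \<otimes>\<^bsub>F2_vec k\<^esub> f2_permute k s w"
  using Bij_inv_in(1)[OF assms] by (auto simp: f2_permute_def F2_vec_mult fun_eq_iff)

lemma f2_permute_all_ones: "s \<in> Bij {0..k} \<Longrightarrow> f2_permute k s (all_ones k) = all_ones k"
  using Bij_inv_in(1)[of s "{0..k}"] by (auto simp: f2_permute_def all_ones_def fun_eq_iff)

text \<open>Permuting coordinates is additive and fixes the all-ones vector, so it commutes with
  taking complements.\<close>

lemma permute_coset_eq:
  assumes "s \<in> Bij {0..k}" "v \<in> carrier (F2_vec k)"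
  shows "permute_coset k s (f2_coset k v) = f2_coset k (f2_permute k s v)"
proof -
  have "permute_coset k s K = f2_permute k s ` K" for K
    by (simp add: permute_coset_def f2_permute_def)
  then show ?thesis
    using assms by (simp add: f2_coset_eq f2_permute_in f2_permute_add f2_permute_all_ones)
qed

lemma f2_permute_id: "v \<in> carrier (F2_vec k) \<Longrightarrow> f2_permute k (\<lambda>i\<in>{0..k}. i) v = v"
proof (rule F2_vec_ext)
  have id: "(\<lambda>i\<in>{0..k}. i) \<in> Bij {0..k}" by (rule id_Bij)
  assume v: "v \<in> carrier (F2_vec k)"
  then show "f2_permute k (\<lambda>i\<in>{0..k}. i) v \<in> carrier (F2_vec k)" "v \<in> carrier (F2_vec k)"
    by (simp_all add: f2_permute_in id)
  fix i assume i: "i \<in> {0..k}"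
  then have "inv_into {0..k} (\<lambda>i\<in>{0..k}. i) i = i"
    using Bij_inv_in[OF id i] by simp
  then show "f2_permute k (\<lambda>i\<in>{0..k}. i) v i = v i" using i by (simp add: f2_permute_def)
qed

text \<open>Inverting a composite reverses the order, and precomposition reverses it again; the
  inverse in \<open>f2_permute\<close> thus makes it a left action.\<close>

lemma f2_permute_compose:
  assumes s: "s \<in> Bij {0..k}" and t: "t \<in> Bij {0..k}"
  shows "f2_permute k (compose {0..k} s t) v = f2_permute k s (f2_permute k t v)"
proof
  fix i
  let ?I = "{0..k}"
  have "inv_into ?I (compose ?I s t) i = inv_into ?I t (inv_into ?I s i)" if i: "i \<in> ?I"
  proof (rule inv_into_f_eq)
    show "inj_on (compose ?I s t) ?I"
      using compose_Bij[OF s t] by (simp add: Bij_def bij_betw_def)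
    show "inv_into ?I t (inv_into ?I s i) \<in> ?I"
      by (rule Bij_inv_in(1)[OF t Bij_inv_in(1)[OF s i]])
    then show "compose ?I s t (inv_into ?I t (inv_into ?I s i)) = i"
      using Bij_inv_in(2)[OF s i] Bij_inv_in(2)[OF t Bij_inv_in(1)[OF s i]] by (simp add: compose_def)
  qed
  then show "f2_permute k (compose ?I s t) v i = f2_permute k s (f2_permute k t v) i"
    using Bij_inv_in(1)[OF s] by (simp add: f2_permute_def)
qed

interpretation F2_action: group_acting_by_automorphisms "F2_quot k" "BijGroup {0..k}" "permute_coset k" for k
proof (intro group_acting_by_automorphisms.intro group_acting_by_automorphisms_axioms.intro
    group_F2_quot group_BijGroup)
  fix s a assume s: "s \<in> carrier (BijGroup {0..k})" and a: "a \<in> carrier (F2_quot k)"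
  then obtain v where v: "v \<in> carrier (F2_vec k)" "a = f2_coset k v" by (auto simp: F2_quot_carrier)
  show "permute_coset k s a \<in> carrier (F2_quot k)"
    using s v by (simp add: BijGroup_carrier permute_coset_eq f2_coset_in f2_permute_in)
  {
    fix b assume "b \<in> carrier (F2_quot k)"
    then obtain w where w: "w \<in> carrier (F2_vec k)" "b = f2_coset k w" by (auto simp: F2_quot_carrier)
    show "permute_coset k s (a \<otimes>\<^bsub>F2_quot k\<^esub> b) = permute_coset k s a \<otimes>\<^bsub>F2_quot k\<^esub> permute_coset k s b"
      using s v w by (simp add: BijGroup_carrier permute_coset_eq F2_quot_mult f2_permute_in f2_permute_add)
  }
  {
    fix t assume "t \<in> carrier (BijGroup {0..k})"
    then show "permute_coset k (s \<otimes>\<^bsub>BijGroup {0..k}\<^esub> t) a = permute_coset k s (permute_coset k t a)"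
      using s v by (simp add: BijGroup_def permute_coset_eq f2_permute_in f2_permute_compose compose_Bij)
  }
next
  fix a assume "a \<in> carrier (F2_quot k)"
  then obtain v where v: "v \<in> carrier (F2_vec k)" "a = f2_coset k v" by (auto simp: F2_quot_carrier)
  then show "permute_coset k \<one>\<^bsub>BijGroup {0..k}\<^esub> a = a"
    by (simp add: BijGroup_def permute_coset_eq id_Bij f2_permute_id)
qed

lemma group_C2_semidirect_Sym: "group (C2_semidirect_Sym k)"
  unfolding C2_semidirect_Sym_def by (rule F2_action.group_semidirect_product)

lemma C2_semidirect_Sym_carrier:
  "carrier (C2_semidirect_Sym k) = carrier (F2_quot k) \<times> Bij {0..k}"
  by (simp add: C2_semidirect_Sym_def semidirect_product_def BijGroup_carrier)

text \<open>The pair \<open>(K, s)\<close> is read as the affine map with linear part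
  \<open>s\<close> and translation \<open>K\<close>; composing such maps is multiplication in the
  semidirect product.\<close>

definition affine_act :: "nat \<Rightarrow> (nat \<Rightarrow> int) set \<times> (nat \<Rightarrow> nat) \<Rightarrow> (nat \<Rightarrow> int) set \<Rightarrow> (nat \<Rightarrow> int) set" where
  "affine_act k h a = fst h \<otimes>\<^bsub>F2_quot k\<^esub> permute_coset k (snd h) a"

lemma affine_act_closed:
  "h \<in> carrier (C2_semidirect_Sym k) \<Longrightarrow> a \<in> carrier (F2_quot k) \<Longrightarrow>
    affine_act k h a \<in> carrier (F2_quot k)"
  by (auto simp: affine_act_def C2_semidirect_Sym_carrier BijGroup_carrier[symmetric]
      F2_action.act_closed)

lemma affine_act_one:
  "a \<in> carrier (F2_quot k) \<Longrightarrow> affine_act k \<one>\<^bsub>C2_semidirect_Sym k\<^esub> a = a"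
  by (simp add: affine_act_def C2_semidirect_Sym_def semidirect_product_def F2_action.act_one)

lemma affine_act_mult:
  "h \<in> carrier (C2_semidirect_Sym k) \<Longrightarrow> h' \<in> carrier (C2_semidirect_Sym k) \<Longrightarrow>
    a \<in> carrier (F2_quot k) \<Longrightarrow>
    affine_act k (h \<otimes>\<^bsub>C2_semidirect_Sym k\<^esub> h') a = affine_act k h (affine_act k h' a)"
  by (auto simp: affine_act_def C2_semidirect_Sym_def semidirect_product_def
      F2_action.act_closed F2_action.act_add F2_action.act_mult F2_action.N.m_assoc)

lemma affine_act_coset:
  assumes "w \<in> carrier (F2_vec k)" "s \<in> Bij {0..k}" "v \<in> carrier (F2_vec k)"
  shows "affine_act k (f2_coset k w, s) (f2_coset k v) =
    f2_coset k (w \<otimes>\<^bsub>F2_vec k\<^esub> f2_permute k s v)"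
  using assms by (simp add: affine_act_def permute_coset_eq F2_quot_mult f2_permute_in)

text \<open>For \<open>k = 1\<close> the two unit vectors are congruent modulo the all-ones vector, so the
  transposition acts trivially; evenness excludes this.\<close>

lemma affine_act_faithful:
  assumes k: "even k" and h: "h \<in> carrier (C2_semidirect_Sym k)"
    and fix_all: "\<And>a. a \<in> carrier (F2_quot k) \<Longrightarrow> affine_act k h a = a"
  shows "h = \<one>\<^bsub>C2_semidirect_Sym k\<^esub>"
proof -
  obtain K s where hs: "h = (K, s)" and K: "K \<in> carrier (F2_quot k)" and s: "s \<in> Bij {0..k}"
    using h by (auto simp: C2_semidirect_Sym_carrier)
  \<comment> \<open>The image of the zero class is the translation part.\<close>
  have K1: "K = \<one>\<^bsub>F2_quot k\<^esub>"
    using fix_all[of "\<one>\<^bsub>F2_quot k\<^esub>"] K s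
    by (simp add: hs affine_act_def F2_action.act_zero BijGroup_carrier)
  have perm: "f2_coset k (f2_permute k s v) = f2_coset k v" if "v \<in> carrier (F2_vec k)" for v
    using fix_all[OF f2_coset_in[OF that]] s that
    by (simp add: hs affine_act_def K1 permute_coset_eq f2_coset_in f2_permute_in)
  have "s i = i" if i: "i \<in> {0..k}" for i
  proof (rule ccontr)
    assume ne: "s i \<noteq> i"
    \<comment> \<open>The unit vector at \<open>i\<close>, which \<open>s\<close> sends to the unit
      vector at \<open>s i\<close>. These two differ, so equal classes would make them complementary
      and leave only the two indices \<open>i\<close> and \<open>s i\<close>, whereas
      \<open>k + 1\<close> is odd.\<close>
    define e :: "nat \<Rightarrow> int" where "e = (\<lambda>l\<in>{0..k}. if l = i then 1 else 0)"
    have e: "e \<in> carrier (F2_vec k)" by (simp add: F2_vec_carrier_iff e_def)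
    have si: "s i \<in> {0..k}" by (rule funcset_mem[OF Bij_imp_funcset[OF s] i])
    have inv_si: "inv_into {0..k} s l = i \<longleftrightarrow> l = s i" if "l \<in> {0..k}" for l
    proof
      assume "l = s i"
      then show "inv_into {0..k} s l = i"
        using s i inv_into_f_f[of s "{0..k}" i] by (simp add: Bij_def bij_betw_def)
    qed (use Bij_inv_in(2)[OF s that] in simp)
    have pe: "f2_permute k s e l = (if l = s i then 1 else 0)" if "l \<in> {0..k}" for l
      using that Bij_inv_in(1)[OF s that] inv_si[OF that] by (simp add: f2_permute_def e_def)
    have "e = f2_permute k s e \<or> e = all_ones k \<otimes>\<^bsub>F2_vec k\<^esub> f2_permute k s e"
      using perm[OF e] f2_coset_eq_iff[OF f2_permute_in[OF s e] e] by simp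
    moreover have "e \<noteq> f2_permute k s e"
      using pe[OF i] ne i by (auto simp: e_def)
    ultimately have *: "e l = 1 - f2_permute k s e l" if "l \<in> {0..k}" for l
      using add_all_ones[OF f2_permute_in[OF s e] that] by simp
    have "l = i \<or> l = s i" if "l \<in> {0..k}" for l
      using *[OF that] pe[OF that] that by (auto simp: e_def split: if_splits)
    then have "{0..k} = {i, s i}" using i si by blast
    then have "card {0..k} = card {i, s i}" by simp
    then show False using ne k by simp
  qed
  then have "s = (\<lambda>i\<in>{0..k}. i)"
    using s by (intro extensionalityI[of s "{0..k}"]) (auto simp: Bij_def)
  then show ?thesis
    by (simp add: hs K1 C2_semidirect_Sym_def semidirect_product_def BijGroup_def)
qed

text \<open>The entry 0 at index 0 matches the convention that \<open>sgn_vec x 0\<close> is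
  1.\<close>

definition position_vec :: "nat \<Rightarrow> (nat \<Rightarrow> nat) \<Rightarrow> nat \<Rightarrow> int" where
  "position_vec k x = (\<lambda>i\<in>{0..k}. if i = 0 then 0 else int (x i))"

lemma position_vec_in: "x \<in> positions k \<Longrightarrow> position_vec k x \<in> carrier (F2_vec k)"
  using positions_cases[of x k] by (force simp: F2_vec_carrier_iff position_vec_def)

text \<open>Complementing changes the entry at index 0, so each class has exactly one representative
  vanishing there.\<close>

lemma bij_betw_position_coset:
  "bij_betw (\<lambda>x. f2_coset k (position_vec k x)) (positions k) (carrier (F2_quot k))"
  unfolding bij_betw_def
proof (intro conjI equalityI subsetI)
  show "inj_on (\<lambda>x. f2_coset k (position_vec k x)) (positions k)"
  proof (rule inj_onI)
    fix x y assume xy: "x \<in> positions k" "y \<in> positions k"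
      and "f2_coset k (position_vec k x) = f2_coset k (position_vec k y)"
    then have "position_vec k y = position_vec k x \<or>
        position_vec k y = all_ones k \<otimes>\<^bsub>F2_vec k\<^esub> position_vec k x"
      using f2_coset_eq_iff[OF position_vec_in[OF xy(1)] position_vec_in[OF xy(2)]] by simp
    moreover have "position_vec k y 0 \<noteq> (all_ones k \<otimes>\<^bsub>F2_vec k\<^esub> position_vec k x) 0"
      using add_all_ones[OF position_vec_in[OF xy(1)], of 0] by (simp add: position_vec_def)
    ultimately have eq: "position_vec k y = position_vec k x" by metis
    show "x = y"
    proof (rule positions_ext[OF xy])
      fix i assume "i \<in> {1..k}"
      then show "x i = y i" using fun_cong[OF eq, of i] by (simp add: position_vec_def)
    qed
  qed
next
  fix a assume "a \<in> (\<lambda>x. f2_coset k (position_vec k x)) ` positions k"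
  then show "a \<in> carrier (F2_quot k)" by (auto intro: f2_coset_in position_vec_in)
next
  fix a assume "a \<in> carrier (F2_quot k)"
  then obtain v where v: "v \<in> carrier (F2_vec k)" "a = f2_coset k v" by (auto simp: F2_quot_carrier)
  have "\<exists>w\<in>carrier (F2_vec k). a = f2_coset k w \<and> w 0 = 0"
  proof (cases "v 0 = 0")
    case False
    let ?w = "all_ones k \<otimes>\<^bsub>F2_vec k\<^esub> v"
    have w: "?w \<in> carrier (F2_vec k)" using v all_ones_in by simp
    moreover have "a = f2_coset k ?w" using v f2_coset_eq_iff[OF v(1) w] by simp
    moreover have "?w 0 = 0" using False F2_vec_cases[OF v(1), of 0] add_all_ones[OF v(1), of 0] by simp
    ultimately show ?thesis by blast
  qed (use v in blast)
  then obtain w where w: "w \<in> carrier (F2_vec k)" "a = f2_coset k w" "w 0 = 0" by blast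
  define x where "x = (\<lambda>i\<in>{1..k}. nat (w i))"
  have "x \<in> positions k" using F2_vec_cases[OF w(1)] by (force simp: x_def positions_def)
  moreover have "position_vec k x = w"
    by (rule F2_vec_ext[OF position_vec_in[OF \<open>x \<in> positions k\<close>] w(1)])
      (use F2_vec_cases[OF w(1)] w(3) in \<open>force simp: position_vec_def x_def\<close>)
  ultimately show "a \<in> (\<lambda>x. f2_coset k (position_vec k x)) ` positions k" using w(2) by blast
qed

section \<open>Order of the semidirect product\<close>

lemma card_F2_quot: "card (carrier (F2_quot k)) = 2 ^ k"
  using bij_betw_same_card[OF bij_betw_position_coset] card_positions by simp

lemma card_Bij:
  assumes "finite S"
  shows "card (Bij S) = fact (card S)"
proof -
  have "bij_betw (\<lambda>p. restrict p S) {p. p permutes S} (Bij S)"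
  proof (rule bij_betw_byWitness[where f' = "\<lambda>s i. if i \<in> S then s i else i"])
    show "\<forall>p\<in>{p. p permutes S}. (\<lambda>i. if i \<in> S then restrict p S i else i) = p"
      by (auto simp: fun_eq_iff permutes_not_in)
    show "\<forall>s\<in>Bij S. restrict (\<lambda>i. if i \<in> S then s i else i) S = s"
      by (auto simp: fun_eq_iff Bij_def extensional_def)
    show "(\<lambda>p. restrict p S) ` {p. p permutes S} \<subseteq> Bij S"
      by (auto simp: Bij_def bij_betw_restrict_eq permutes_imp_bij)
    show "(\<lambda>s i. if i \<in> S then s i else i) ` Bij S \<subseteq> {p. p permutes S}"
    proof clarify
      fix s assume "s \<in> Bij S"
      then have "bij_betw (\<lambda>i. if i \<in> S then s i else i) S S"
        using bij_betw_cong[of S s "\<lambda>i. if i \<in> S then s i else i" S] by (simp add: Bij_def)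
      then show "(\<lambda>i. if i \<in> S then s i else i) permutes S"
        by (rule bij_imp_permutes) simp
    qed
  qed
  then show ?thesis
    using bij_betw_same_card card_permutations[OF refl assms] by metis
qed

lemma card_C2_semidirect_Sym: "card (carrier (C2_semidirect_Sym k)) = 2 ^ k * fact (k + 1)"
  by (simp add: C2_semidirect_Sym_carrier card_cartesian_product card_F2_quot card_Bij)

section \<open>Orbits of magic-faced labelings\<close>

definition f2_sign :: "(nat \<Rightarrow> int) \<Rightarrow> nat \<Rightarrow> real" where
  "f2_sign v i = (-1) ^ nat (v i)"

lemma f2_sign_cases: "f2_sign v i = 1 \<or> f2_sign v i = -1"
  by (cases "even (nat (v i))") (auto simp: f2_sign_def)

section \<open>Twisted forms on classes and under affine maps\<close>

lemma twisted_cong: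
  assumes "\<And>i. i \<in> {0..k} \<Longrightarrow> b i = b' i" "\<And>i. i \<in> {0..k} \<Longrightarrow> e i = e' i"
  shows "twisted k b e = twisted k b' e'"
proof -
  have "(\<Prod>i\<in>{0..k}. e i) = (\<Prod>i\<in>{0..k}. e' i)" by (rule prod.cong) (auto simp: assms)
  moreover have "(\<Sum>i\<in>{0..k}. b i * e i) = (\<Sum>i\<in>{0..k}. b' i * e' i)"
    by (rule sum.cong) (auto simp: assms)
  ultimately show ?thesis by (simp add: twisted_def)
qed

lemma twisted_scale: "twisted k (\<lambda>i. c * b i) e = c * twisted k b e"
  by (simp add: twisted_def sum_distrib_left mult_ac)

lemma f2_sign_position_vec: "i \<in> {0..k} \<Longrightarrow> f2_sign (position_vec k x) i = sgn_vec x i"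
  by (simp add: f2_sign_def position_vec_def sgn_vec_def)

lemma f2_sign_add:
  assumes "v \<in> carrier (F2_vec k)" "w \<in> carrier (F2_vec k)" "i \<in> {0..k}"
  shows "f2_sign (v \<otimes>\<^bsub>F2_vec k\<^esub> w) i = f2_sign v i * f2_sign w i"
  using F2_vec_cases[OF assms(1,3)] F2_vec_cases[OF assms(2,3)] assms(3)
  by (auto simp: f2_sign_def F2_vec_mult)

lemma f2_sign_permute: "i \<in> {0..k} \<Longrightarrow> f2_sign (f2_permute k s v) i = f2_sign v (inv_into {0..k} s i)"
  by (simp add: f2_sign_def f2_permute_def)

text \<open>Complementing negates all \<open>k + 1\<close> signs. As \<open>k + 1\<close> is odd,
  both the product and the linear sum change sign, and the two changes cancel.\<close>

lemma twisted_add_all_ones: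
  assumes k: "even k" and v: "v \<in> carrier (F2_vec k)"
  shows "twisted k b (f2_sign (all_ones k \<otimes>\<^bsub>F2_vec k\<^esub> v)) = twisted k b (f2_sign v)"
proof -
  have "twisted k b (f2_sign (all_ones k \<otimes>\<^bsub>F2_vec k\<^esub> v)) = twisted k b (\<lambda>i. - f2_sign v i)"
  proof (rule twisted_cong[OF refl])
    fix i assume i: "i \<in> {0..k}"
    have "f2_sign (all_ones k) i = -1" using i by (simp add: f2_sign_def all_ones_def)
    then show "f2_sign (all_ones k \<otimes>\<^bsub>F2_vec k\<^esub> v) i = - f2_sign v i"
      using f2_sign_add[OF all_ones_in v i] by simp
  qed
  also have "\<dots> = twisted k b (f2_sign v)"
    using k by (simp add: twisted_def sum_negf prod_uminus)
  finally show ?thesis .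
qed

lemma twisted_f2_coset:
  assumes "even k" "v \<in> carrier (F2_vec k)" "w \<in> carrier (F2_vec k)" "f2_coset k v = f2_coset k w"
  shows "twisted k b (f2_sign v) = twisted k b (f2_sign w)"
  using assms f2_coset_eq_iff[OF assms(2,3)] twisted_add_all_ones by auto

text \<open>A translation multiplies signs and a permutation reindexes them, so affine maps act on
  coefficients by signed permutations, up to the total sign of \<open>w\<close>. That extra sign is
  absorbed by the zero coefficient for even dimension and by the factor \<open>C2\<close> for odd
  dimension.\<close>

lemma twisted_affine:
  assumes w: "w \<in> carrier (F2_vec k)" and s: "s \<in> Bij {0..k}" and v: "v \<in> carrier (F2_vec k)"
  shows "twisted k b (f2_sign (w \<otimes>\<^bsub>F2_vec k\<^esub> f2_permute k s v)) =
    twisted k (\<lambda>i. (\<Prod>l\<in>{0..k}. f2_sign w l) * (f2_sign w (s i) * b (s i))) (f2_sign v)"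
proof -
  let ?I = "{0..k}"
  define e where "e i = f2_sign w i * f2_sign v (inv_into ?I s i)" for i
  have bij: "bij_betw s ?I ?I" using s by (simp add: Bij_def)
  have inv: "inv_into ?I s (s i) = i" if "i \<in> ?I" for i
    using that bij by (simp add: bij_betw_def)
  have "twisted k b (f2_sign (w \<otimes>\<^bsub>F2_vec k\<^esub> f2_permute k s v)) = twisted k b e"
    using w s v by (intro twisted_cong)
      (simp_all add: f2_sign_add f2_permute_in f2_sign_permute e_def)
  moreover have "(\<Prod>i\<in>?I. e i) = (\<Prod>i\<in>?I. f2_sign w i) * (\<Prod>i\<in>?I. f2_sign v i)"
  proof -
    have "(\<Prod>i\<in>?I. f2_sign v (inv_into ?I s i)) = (\<Prod>i\<in>?I. f2_sign v i)"
      by (rule prod.reindex_bij_betw[OF bij_betw_inv_into[OF bij]])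
    then show ?thesis by (simp add: e_def prod.distrib)
  qed
  moreover have "(\<Sum>i\<in>?I. b i * e i) = (\<Sum>i\<in>?I. f2_sign w (s i) * b (s i) * f2_sign v i)"
  proof -
    have "(\<Sum>i\<in>?I. b i * e i) = (\<Sum>i\<in>?I. b (s i) * e (s i))"
      by (rule sum.reindex_bij_betw[OF bij, symmetric])
    also have "\<dots> = (\<Sum>i\<in>?I. f2_sign w (s i) * b (s i) * f2_sign v i)"
      by (rule sum.cong) (simp_all add: e_def inv mult_ac)
    finally show ?thesis .
  qed
  ultimately show ?thesis
    unfolding twisted_scale by (simp add: twisted_def mult_ac)
qed

text \<open>The permutation \<open>s\<close> matches equal absolute values; \<open>w\<close> records
  the sign of \<open>b i\<close> at the target index \<open>s i\<close>.\<close>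

lemma signed_permutation_exists:
  fixes b b0 :: "nat \<Rightarrow> real"
  assumes b0: "bij_betw b0 {0..k} W" "\<And>i. i \<in> {0..k} \<Longrightarrow> b0 i \<ge> 0"
    and b: "bij_betw (\<lambda>i. \<bar>b i\<bar>) {0..k} W"
  shows "\<exists>s\<in>Bij {0..k}. \<exists>w\<in>carrier (F2_vec k). \<forall>i\<in>{0..k}. b i = f2_sign w (s i) * b0 (s i)"
proof -
  let ?I = "{0..k}"
  define s where "s = (\<lambda>i\<in>?I. inv_into ?I b0 \<bar>b i\<bar>)"
  define w :: "nat \<Rightarrow> int" where "w = (\<lambda>l\<in>?I. if b (inv_into ?I s l) < 0 then 1 else 0)"
  have bij: "bij_betw s ?I ?I"
    using bij_betw_trans[OF b bij_betw_inv_into[OF b0(1)]]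
    by (simp add: s_def bij_betw_restrict_eq o_def)
  then have "s \<in> Bij ?I" by (simp add: Bij_def s_def)
  moreover have "w \<in> carrier (F2_vec k)" by (simp add: F2_vec_carrier_iff w_def)
  moreover have "b i = f2_sign w (s i) * b0 (s i)" if i: "i \<in> ?I" for i
  proof -
    have "\<bar>b i\<bar> \<in> W" using b i by (auto simp: bij_betw_def)
    then have "b0 (s i) = \<bar>b i\<bar>"
      using i bij_betw_inv_into_right[OF b0(1)] by (simp add: s_def)
    moreover have "f2_sign w (s i) = (if b i < 0 then -1 else 1)"
      using bij_betwE[OF bij] i bij_betw_inv_into_left[OF bij i] by (simp add: f2_sign_def w_def)
    ultimately show ?thesis by simp
  qed
  ultimately show ?thesis by blast
qed

lemma bij_betw_insert_zero:
  fixes b :: "nat \<Rightarrow> real"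
  assumes "bij_betw b (I - {j}) ((\<lambda>r. 2 ^ r) ` {..<n::nat})" "j \<in> I" "b j = 0"
  shows "bij_betw b I (insert 0 ((\<lambda>r. 2 ^ r) ` {..<n}))"
proof -
  have "bij_betw b ((I - {j}) \<union> {j}) ((\<lambda>r. 2 ^ r) ` {..<n} \<union> {0})"
    using assms(1) by (rule bij_betw_combine) (auto simp: assms(3) bij_betw_def)
  then show ?thesis using assms(2) by (simp add: insert_absorb)
qed

lemma base_coeffs_bij:
  assumes "j \<le> n"
  shows "bij_betw (base_coeffs j) ({0..n} - {j}) ((\<lambda>r. 2 ^ r) ` {..<n})"
proof -
  have "bij_betw (\<lambda>r. 2 ^ r :: real) {..<n} ((\<lambda>r. 2 ^ r) ` {..<n})"
    by (rule inj_on_imp_bij_betw) (simp add: inj_on_def)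
  from bij_betw_trans[OF bij_betw_skip[OF assms] this] show ?thesis
    by (rule iffD1[OF bij_betw_cong, rotated]) (auto simp: base_coeffs_def)
qed

lemma labels_eq_of_represents:
  assumes "represents n b A" "represents n b' A'" "x \<in> positions n" "y \<in> positions n"
    and "twisted n b (sgn_vec x) = twisted n b' (sgn_vec y)"
  shows "A x = A' y"
proof -
  have "2 * real (A x) - (2 ^ n + 1) = 2 * real (A' y) - (2 ^ n + 1)"
    using assms by (simp add: represents_def)
  then show ?thesis by simp
qed

section \<open>Even dimension\<close>

text \<open>Positions become classes modulo the all-ones vector. The zero coefficient may sit at any
  index in \<open>{0..n}\<close>, but permutations of these indices move it to 0, so a single base
  labeling reaches all others.\<close>

lemma even_orbit:
  assumes n: "even n"
  shows "(\<exists>G. subgroup G (BijGroup (positions n)) \<and>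
      (BijGroup (positions n))\<lparr>carrier := G\<rparr> \<cong> C2_semidirect_Sym n \<and> single_orbit n G (magic_faced n))
    \<and> card (magic_faced n) = card (carrier (C2_semidirect_Sym n))"
proof -
  let ?b0 = "base_coeffs 0" and ?\<theta> = "\<lambda>x. f2_coset n (position_vec n x)"
  obtain A0 where A0: "A0 \<in> labelings n" and rep0: "represents n ?b0 A0"
    using base_labeling[of 0 n] n by auto
  \<comment> \<open>Here \<open>y\<close> is the image of \<open>x\<close> under the group element:
    moving the position is traded for a signed permutation of the coefficients of
    \<open>A0\<close>.\<close>
  have key: "twisted n ?b0 (sgn_vec y) =
      twisted n (\<lambda>i. (\<Prod>l\<in>{0..n}. f2_sign w l) * (f2_sign w (s i) * ?b0 (s i))) (sgn_vec x)"
    if w: "w \<in> carrier (F2_vec n)" and s: "s \<in> Bij {0..n}"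
      and xy: "x \<in> positions n" "y \<in> positions n" and eq: "?\<theta> y = affine_act n (f2_coset n w, s) (?\<theta> x)"
    for w s x y
  proof -
    note vx = position_vec_in[OF xy(1)] and vy = position_vec_in[OF xy(2)]
    have "twisted n ?b0 (sgn_vec y) = twisted n ?b0 (f2_sign (position_vec n y))"
      by (rule twisted_cong) (simp_all add: f2_sign_position_vec)
    also have "\<dots> = twisted n ?b0 (f2_sign (w \<otimes>\<^bsub>F2_vec n\<^esub> f2_permute n s (position_vec n x)))"
      using eq vx vy w s by (intro twisted_f2_coset[OF n]) (simp_all add: affine_act_coset f2_permute_in)
    also have "\<dots> = twisted n (\<lambda>i. (\<Prod>l\<in>{0..n}. f2_sign w l) * (f2_sign w (s i) * ?b0 (s i)))
        (f2_sign (position_vec n x))"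
      by (rule twisted_affine[OF w s vx])
    also have "\<dots> = twisted n (\<lambda>i. (\<Prod>l\<in>{0..n}. f2_sign w l) * (f2_sign w (s i) * ?b0 (s i))) (sgn_vec x)"
      by (rule twisted_cong) (simp_all add: f2_sign_position_vec)
    finally show ?thesis .
  qed
  have M: "A \<in> magic_faced n \<longleftrightarrow> (\<exists>h\<in>carrier (C2_semidirect_Sym n). \<forall>x\<in>positions n. \<forall>y\<in>positions n.
      ?\<theta> y = affine_act n h (?\<theta> x) \<longrightarrow> A x = A0 y)" if A: "A \<in> labelings n" for A
  proof
    assume "A \<in> magic_faced n"
    then obtain b where rep: "represents n b A" using magic_represented by blast
    then obtain j where j: "j \<in> {0..n}" "b j = 0"
      and bb: "bij_betw (\<lambda>i. \<bar>b i\<bar>) ({0..n} - {j}) ((\<lambda>r. 2 ^ r) ` {..<n})"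
      using represents_classification[OF A] by blast
    \<comment> \<open>The value 0 is matched along with the powers of two, so the permutation acts
      on all \<open>n + 1\<close> indices.\<close>
    have "bij_betw ?b0 {0..n} (insert 0 ((\<lambda>r. 2 ^ r) ` {..<n}))"
      by (rule bij_betw_insert_zero[OF base_coeffs_bij]) (auto simp: base_coeffs_def)
    moreover have "?b0 i \<ge> 0" for i by (simp add: base_coeffs_def)
    moreover have "bij_betw (\<lambda>i. \<bar>b i\<bar>) {0..n} (insert 0 ((\<lambda>r. 2 ^ r) ` {..<n}))"
      by (rule bij_betw_insert_zero[OF bb j(1)]) (simp add: j(2))
    ultimately obtain s w where s: "s \<in> Bij {0..n}" and w: "w \<in> carrier (F2_vec n)"
      and bw: "\<And>i. i \<in> {0..n} \<Longrightarrow> b i = f2_sign w (s i) * ?b0 (s i)"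
      using signed_permutation_exists[of ?b0 n _ b] by blast
    \<comment> \<open>The sign at the vanishing coefficient is free, so it can be used to fix the parity.\<close>
    have "\<exists>w\<in>carrier (F2_vec n). (\<Prod>l\<in>{0..n}. f2_sign w l) = 1 \<and>
        (\<forall>i\<in>{0..n}. b i = f2_sign w (s i) * ?b0 (s i))"
    proof (cases "(\<Prod>l\<in>{0..n}. f2_sign w l) = 1")
      case False
      then have neg: "(\<Prod>l\<in>{0..n}. f2_sign w l) = -1"
        using prod_signs[of "{0..n}" "f2_sign w"] f2_sign_cases by blast
      define w' where "w' = w(0 := 1 - w 0)"
      have w': "w' \<in> carrier (F2_vec n)"
        using w F2_vec_cases[OF w, of 0] by (auto simp: F2_vec_carrier_iff w'_def extensional_def)
      have sw': "f2_sign w' = (f2_sign w)(0 := - f2_sign w 0)"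
        using F2_vec_cases[OF w, of 0] by (auto simp: f2_sign_def w'_def)
      have "(\<Prod>l\<in>{0..n}. f2_sign w' l) = 1"
        unfolding sw' using prod_negate_one[of "{0..n}" 0 "f2_sign w"] neg by simp
      moreover have "b i = f2_sign w' (s i) * ?b0 (s i)" if "i \<in> {0..n}" for i
        using bw[OF that] by (simp add: sw' base_coeffs_def)
      ultimately show ?thesis using w' by blast
    qed (use w bw in blast)
    then obtain w where w: "w \<in> carrier (F2_vec n)" and P: "(\<Prod>l\<in>{0..n}. f2_sign w l) = 1"
      and bw: "\<And>i. i \<in> {0..n} \<Longrightarrow> b i = f2_sign w (s i) * ?b0 (s i)" by blast
    show "\<exists>h\<in>carrier (C2_semidirect_Sym n). \<forall>x\<in>positions n. \<forall>y\<in>positions n.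
      ?\<theta> y = affine_act n h (?\<theta> x) \<longrightarrow> A x = A0 y"
    proof (intro bexI ballI impI)
      show "(f2_coset n w, s) \<in> carrier (C2_semidirect_Sym n)"
        using w s by (simp add: C2_semidirect_Sym_carrier f2_coset_in)
      fix x y assume xy: "x \<in> positions n" "y \<in> positions n"
        and eq: "?\<theta> y = affine_act n (f2_coset n w, s) (?\<theta> x)"
      show "A x = A0 y"
      proof (rule labels_eq_of_represents[OF rep rep0 xy])
        show "twisted n b (sgn_vec x) = twisted n ?b0 (sgn_vec y)"
          unfolding key[OF w s xy eq] by (rule twisted_cong) (simp_all add: P bw)
      qed
    qed
  next
    assume "\<exists>h\<in>carrier (C2_semidirect_Sym n). \<forall>x\<in>positions n. \<forall>y\<in>positions n.
      ?\<theta> y = affine_act n h (?\<theta> x) \<longrightarrow> A x = A0 y"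
    then obtain h where h: "h \<in> carrier (C2_semidirect_Sym n)"
      and eq: "\<And>x y. x \<in> positions n \<Longrightarrow> y \<in> positions n \<Longrightarrow> ?\<theta> y = affine_act n h (?\<theta> x) \<Longrightarrow> A x = A0 y"
      by (elim bexE) simp
    obtain w s where w: "w \<in> carrier (F2_vec n)" and s: "s \<in> Bij {0..n}" and hws: "h = (f2_coset n w, s)"
      using h by (auto simp: C2_semidirect_Sym_carrier F2_quot_carrier)
    \<comment> \<open>Conversely, a moved copy of \<open>A0\<close> is again a twisted form and
      therefore magic-faced.\<close>
    have "represents n (\<lambda>i. (\<Prod>l\<in>{0..n}. f2_sign w l) * (f2_sign w (s i) * ?b0 (s i))) A"
      unfolding represents_def
    proof
      fix x assume x: "x \<in> positions n"
      have "?\<theta> x \<in> carrier (F2_quot n)" using x by (simp add: f2_coset_in position_vec_in)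
      then have "affine_act n h (?\<theta> x) \<in> carrier (F2_quot n)" by (rule affine_act_closed[OF h])
      then obtain y where y: "y \<in> positions n" "?\<theta> y = affine_act n h (?\<theta> x)"
        using bij_betw_imp_surj_on[OF bij_betw_position_coset[of n]] by (metis (no_types, lifting) imageE)
      then have "A x = A0 y" using eq x by blast
      then show "2 * real (A x) - (2 ^ n + 1) =
          twisted n (\<lambda>i. (\<Prod>l\<in>{0..n}. f2_sign w l) * (f2_sign w (s i) * ?b0 (s i))) (sgn_vec x)"
        using rep0 y key[OF w s x y(1) y(2)[unfolded hws]] by (simp add: represents_def)
    qed
    then show "A \<in> magic_faced n" using A represented_magic by blast
  qed
  have "magic_faced n \<subseteq> labelings n" by (auto simp: magic_faced_def)
  note orb = orbit_of_transported_action[OF group_C2_semidirect_Sym bij_betw_position_coset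
      affine_act_closed affine_act_one affine_act_mult affine_act_faithful[OF n] A0 this M]
  show ?thesis using orb by blast
qed

section \<open>Odd dimension: splitting off the distinguished direction\<close>

text \<open>The increasing enumeration of the naturals other than \<open>j\<close>. For positive
  \<open>j\<close> it fixes 0, so the index with constant sign keeps its role.\<close>

definition skip :: "nat \<Rightarrow> nat \<Rightarrow> nat" where
  "skip j i = (if i < j then i else Suc i)"

definition drop_coordinate :: "nat \<Rightarrow> nat \<Rightarrow> (nat \<Rightarrow> nat) \<Rightarrow> nat \<Rightarrow> nat" where
  "drop_coordinate k j x = (\<lambda>i\<in>{1..k}. x (skip j i))"

lemma skip_bij:
  assumes "j \<in> {1..Suc k}"
  shows "bij_betw (skip j) {0..k} ({0..Suc k} - {j})"
proof (rule bij_betw_byWitness[where f' = "\<lambda>i. if i < j then i else i - 1"])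
qed (use assms in \<open>auto simp: skip_def image_subset_iff\<close>)

lemma skip_in: "j \<in> {1..Suc k} \<Longrightarrow> i \<in> {1..k} \<Longrightarrow> skip j i \<in> {1..Suc k}"
  by (auto simp: skip_def)

lemma drop_coordinate_in:
  assumes "j \<in> {1..Suc k}" "x \<in> positions (Suc k)"
  shows "drop_coordinate k j x \<in> positions k"
  using positions_cases[OF assms(2) skip_in[OF assms(1)]]
  by (simp add: positions_def drop_coordinate_def)

lemma sgn_vec_drop:
  assumes "j \<in> {1..Suc k}" "i \<in> {0..k}"
  shows "sgn_vec (drop_coordinate k j x) i = sgn_vec x (skip j i)"
  using assms by (auto simp: sgn_vec_def drop_coordinate_def skip_def)

text \<open>With zero coefficient at \<open>j\<close>, that coordinate enters only through the
  product of all signs.\<close>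

lemma twisted_drop:
  assumes j: "j \<in> {1..Suc k}" and b: "b j = 0"
  shows "twisted (Suc k) b (sgn_vec x) =
    sgn_vec x j * twisted k (\<lambda>i. b (skip j i)) (sgn_vec (drop_coordinate k j x))"
proof -
  have j0: "j \<in> {0..Suc k}" using j by simp
  have "(\<Prod>i\<in>{0..Suc k}. sgn_vec x i) = sgn_vec x j * (\<Prod>i\<in>{0..Suc k}-{j}. sgn_vec x i)"
    by (rule prod.remove) (use j0 in auto)
  also have "(\<Prod>i\<in>{0..Suc k}-{j}. sgn_vec x i) = (\<Prod>i\<in>{0..k}. sgn_vec x (skip j i))"
    by (rule prod.reindex_bij_betw[OF skip_bij[OF j], symmetric])
  finally have P: "(\<Prod>i\<in>{0..Suc k}. sgn_vec x i) = sgn_vec x j * (\<Prod>i\<in>{0..k}. sgn_vec x (skip j i))" .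
  have "(\<Sum>i\<in>{0..Suc k}. b i * sgn_vec x i) =
      b j * sgn_vec x j + (\<Sum>i\<in>{0..Suc k}-{j}. b i * sgn_vec x i)"
    by (rule sum.remove) (use j0 in auto)
  also have "\<dots> = (\<Sum>i\<in>{0..k}. b (skip j i) * sgn_vec x (skip j i))"
    using sum.reindex_bij_betw[OF skip_bij[OF j], of "\<lambda>i. b i * sgn_vec x i"] b by simp
  finally have "twisted (Suc k) b (sgn_vec x) =
      sgn_vec x j * twisted k (\<lambda>i. b (skip j i)) (\<lambda>i. sgn_vec x (skip j i))"
    unfolding twisted_def P by simp
  also have "twisted k (\<lambda>i. b (skip j i)) (\<lambda>i. sgn_vec x (skip j i)) =
      twisted k (\<lambda>i. b (skip j i)) (sgn_vec (drop_coordinate k j x))"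
    by (rule twisted_cong) (simp_all add: sgn_vec_drop[OF j])
  finally show ?thesis .
qed

lemma C2_carrier: "carrier C2 = {0, 1}"
  by (auto simp: carrier_integer_mod_group)

definition split_position :: "nat \<Rightarrow> nat \<Rightarrow> (nat \<Rightarrow> nat) \<Rightarrow> (nat \<Rightarrow> int) set \<times> int" where
  "split_position k j x = (f2_coset k (position_vec k (drop_coordinate k j x)), int (x j))"

text \<open>Surjectivity comes from counting: both sides have \<open>2 ^ Suc k\<close>
  elements.\<close>

lemma bij_betw_split_position:
  assumes j: "j \<in> {1..Suc k}"
  shows "bij_betw (split_position k j) (positions (Suc k)) (carrier (F2_quot k) \<times> carrier C2)"
proof -
  let ?Y = "carrier (F2_quot k) \<times> carrier C2"
  have inj: "inj_on (split_position k j) (positions (Suc k))"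
  proof (rule inj_onI)
    fix x y assume xy: "x \<in> positions (Suc k)" "y \<in> positions (Suc k)"
      and eq: "split_position k j x = split_position k j y"
    then have "f2_coset k (position_vec k (drop_coordinate k j x)) =
        f2_coset k (position_vec k (drop_coordinate k j y))"
      by (simp add: split_position_def)
    then have drop_eq: "drop_coordinate k j x = drop_coordinate k j y"
      by (rule inj_onD[OF bij_betw_imp_inj_on[OF bij_betw_position_coset]])
        (use xy in \<open>simp_all add: drop_coordinate_in[OF j]\<close>)
    have d: "x (skip j i) = y (skip j i)" if "i \<in> {1..k}" for i
      using fun_cong[OF drop_eq, of i] that by (simp add: drop_coordinate_def)
    show "x = y"
    proof (rule positions_ext[OF xy])
      fix l assume l: "l \<in> {1..Suc k}"
      show "x l = y l"
      proof (cases "l = j")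
        case False
        let ?i = "if l < j then l else l - 1"
        have "?i \<in> {1..k}" "skip j ?i = l" using l j False by (auto simp: skip_def)
        then show ?thesis using d[of ?i] by simp
      qed (use eq in \<open>simp add: split_position_def\<close>)
    qed
  qed
  moreover have "split_position k j ` positions (Suc k) \<subseteq> ?Y"
  proof (rule image_subsetI)
    fix x assume x: "x \<in> positions (Suc k)"
    show "split_position k j x \<in> ?Y"
      using positions_cases[OF x j] position_vec_in[OF drop_coordinate_in[OF j x]]
      by (auto simp: split_position_def C2_carrier f2_coset_in)
  qed
  moreover have "card ?Y = 2 ^ Suc k"
    by (simp add: card_cartesian_product card_F2_quot C2_carrier)
  moreover have "finite ?Y"
    using card_F2_quot[of k] by (intro finite_cartesian_product) (auto simp: C2_carrier intro: card_ge_0_finite)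
  ultimately show ?thesis
    using card_subset_eq[of ?Y "split_position k j ` positions (Suc k)"]
    by (simp add: bij_betw_def card_image card_positions)
qed

text \<open>Coordinate \<open>j\<close> contributes a single sign factor, on which \<open>C2\<close>
  acts. The other coordinates carry a twisted form of even index \<open>k\<close>, which is well
  defined on classes and is acted on by affine maps.\<close>

lemma odd_orbit:
  assumes k: "even k" and j: "j \<in> {1..Suc k}"
  defines "M \<equiv> {A \<in> magic_faced (Suc k). distinguished_direction (Suc k) j A}"
  shows "(\<exists>G. subgroup G (BijGroup (positions (Suc k))) \<and>
      (BijGroup (positions (Suc k)))\<lparr>carrier := G\<rparr> \<cong> C2_semidirect_Sym k \<times>\<times> C2 \<and>
      single_orbit (Suc k) G M)
    \<and> card M = card (carrier (C2_semidirect_Sym k \<times>\<times> C2))"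
proof -
  let ?n = "Suc k"
  let ?X = "positions ?n" and ?b0 = "base_coeffs j" and ?\<theta> = "split_position k j"
  let ?c0 = "\<lambda>i. ?b0 (skip j i)"
  let ?H = "C2_semidirect_Sym k \<times>\<times> C2" and ?Y = "carrier (F2_quot k) \<times> carrier C2"
  define act :: "((nat \<Rightarrow> int) set \<times> (nat \<Rightarrow> nat)) \<times> int \<Rightarrow> (nat \<Rightarrow> int) set \<times> int \<Rightarrow> (nat \<Rightarrow> int) set \<times> int"
    where "act h y = (affine_act k (fst h) (fst y), snd h \<otimes>\<^bsub>C2\<^esub> snd y)" for h y
  interpret C2: group C2 by simp
  have j0: "j \<in> {0..?n}" using j by simp
  obtain A0 where A0: "A0 \<in> labelings ?n" and rep0: "represents ?n ?b0 A0"
    using base_labeling[of j ?n] j by auto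
  have b0j: "?b0 j = 0" by (simp add: base_coeffs_def)
  \<comment> \<open>Coefficients, away from \<open>j\<close>, of \<open>A0\<close> moved by the
    group element \<open>((f2_coset k w, s), t)\<close>; the entry \<open>t\<close> contributes a
    global sign.\<close>
  define coeffs where "coeffs w s t i =
      (-1) ^ nat t * ((\<Prod>l\<in>{0..k}. f2_sign w l) * (f2_sign w (s i) * ?c0 (s i)))"
    for w :: "nat \<Rightarrow> int" and s :: "nat \<Rightarrow> nat" and t :: int and i
  have key: "twisted ?n ?b0 (sgn_vec y) =
      sgn_vec x j * twisted k (coeffs w s t) (sgn_vec (drop_coordinate k j x))"
    if w: "w \<in> carrier (F2_vec k)" and s: "s \<in> Bij {0..k}" and t: "t \<in> carrier C2"
      and xy: "x \<in> ?X" "y \<in> ?X" and eq: "?\<theta> y = act ((f2_coset k w, s), t) (?\<theta> x)"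
    for w s t x y
  proof -
    let ?x = "drop_coordinate k j x" and ?y = "drop_coordinate k j y"
    note vx = position_vec_in[OF drop_coordinate_in[OF j xy(1)]]
      and vy = position_vec_in[OF drop_coordinate_in[OF j xy(2)]]
    have eq1: "f2_coset k (position_vec k ?y) = affine_act k (f2_coset k w, s) (f2_coset k (position_vec k ?x))"
      and eq2: "int (y j) = (t + int (x j)) mod 2"
      using eq by (simp_all add: split_position_def act_def)
    have sj: "sgn_vec y j = (-1) ^ nat t * sgn_vec x j"
    proof -
      have "t = 0 \<or> t = 1" using t by (simp add: C2_carrier)
      then show ?thesis
        using eq2 positions_cases[OF xy(1) j] positions_cases[OF xy(2) j] j by (auto simp: sgn_vec_def)
    qed
    have "twisted k ?c0 (sgn_vec ?y) = twisted k ?c0 (f2_sign (position_vec k ?y))"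
      by (rule twisted_cong) (simp_all add: f2_sign_position_vec)
    also have "\<dots> = twisted k ?c0 (f2_sign (w \<otimes>\<^bsub>F2_vec k\<^esub> f2_permute k s (position_vec k ?x)))"
      using eq1 vx vy w s by (intro twisted_f2_coset[OF k]) (simp_all add: affine_act_coset f2_permute_in)
    also have "\<dots> = twisted k (\<lambda>i. (\<Prod>l\<in>{0..k}. f2_sign w l) * (f2_sign w (s i) * ?c0 (s i)))
        (f2_sign (position_vec k ?x))"
      by (rule twisted_affine[OF w s vx])
    also have "\<dots> = twisted k (\<lambda>i. (\<Prod>l\<in>{0..k}. f2_sign w l) * (f2_sign w (s i) * ?c0 (s i))) (sgn_vec ?x)"
      by (rule twisted_cong) (simp_all add: f2_sign_position_vec)
    finally show ?thesis
      unfolding twisted_drop[where b = ?b0, OF j b0j] sj coeffs_def[abs_def] twisted_scale by simp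
  qed
  have M: "A \<in> M \<longleftrightarrow> (\<exists>h\<in>carrier ?H. \<forall>x\<in>?X. \<forall>y\<in>?X. ?\<theta> y = act h (?\<theta> x) \<longrightarrow> A x = A0 y)"
    if A: "A \<in> labelings ?n" for A
  proof
    assume AM: "A \<in> M"
    then obtain b where rep: "represents ?n b A" using magic_represented by (auto simp: M_def)
    have bj: "b j = 0" using AM distinguished_direction_iff[OF rep j] by (simp add: M_def)
    obtain j' where j': "j' \<in> {0..?n}"
      and bb: "bij_betw (\<lambda>i. \<bar>b i\<bar>) ({0..?n} - {j'}) ((\<lambda>r. 2 ^ r) ` {..<?n})"
      using represents_classification[OF A rep] by blast
    \<comment> \<open>All coefficients other than the one at \<open>j'\<close> have a power of two
      as absolute value, whereas \<open>b j\<close> vanishes.\<close>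
    have "j' = j"
    proof (rule ccontr)
      assume "j' \<noteq> j"
      then have "\<bar>b j\<bar> \<in> (\<lambda>r. 2 ^ r) ` {..<?n}" using bij_betwE[OF bb] j0 by blast
      then show False using bj by auto
    qed
    have "bij_betw ?c0 {0..k} ((\<lambda>r. 2 ^ r) ` {..<?n})"
      using bij_betw_trans[OF skip_bij[OF j] base_coeffs_bij[of j ?n]] j by (simp add: o_def)
    moreover have "?c0 i \<ge> 0" for i by (simp add: base_coeffs_def)
    moreover have "bij_betw (\<lambda>i. \<bar>b (skip j i)\<bar>) {0..k} ((\<lambda>r. 2 ^ r) ` {..<?n})"
      using bij_betw_trans[OF skip_bij[OF j] bb[unfolded \<open>j' = j\<close>]] by (simp add: o_def)
    ultimately obtain s w where s: "s \<in> Bij {0..k}" and w: "w \<in> carrier (F2_vec k)"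
      and bw: "\<And>i. i \<in> {0..k} \<Longrightarrow> b (skip j i) = f2_sign w (s i) * ?c0 (s i)"
      using signed_permutation_exists[of ?c0 k _ "\<lambda>i. b (skip j i)"] by blast
    \<comment> \<open>Away from \<open>j\<close> no coefficient vanishes, so the total sign of
      \<open>w\<close> cannot be corrected by changing \<open>w\<close>; the \<open>C2\<close>
      component cancels it instead.\<close>
    define t :: int where "t = (if (\<Prod>l\<in>{0..k}. f2_sign w l) = 1 then 0 else 1)"
    have t: "t \<in> carrier C2" by (simp add: t_def C2_carrier)
    have "(\<Prod>l\<in>{0..k}. f2_sign w l) = 1 \<or> (\<Prod>l\<in>{0..k}. f2_sign w l) = -1"
      by (rule prod_signs) (rule f2_sign_cases)
    then have co: "coeffs w s t i = b (skip j i)" if "i \<in> {0..k}" for i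
      using bw[OF that] by (auto simp: coeffs_def t_def)
    show "\<exists>h\<in>carrier ?H. \<forall>x\<in>?X. \<forall>y\<in>?X. ?\<theta> y = act h (?\<theta> x) \<longrightarrow> A x = A0 y"
    proof (intro bexI ballI impI)
      show "((f2_coset k w, s), t) \<in> carrier ?H"
        using w s t by (simp add: C2_semidirect_Sym_carrier f2_coset_in)
      fix x y assume xy: "x \<in> ?X" "y \<in> ?X" and eq: "?\<theta> y = act ((f2_coset k w, s), t) (?\<theta> x)"
      show "A x = A0 y"
      proof (rule labels_eq_of_represents[OF rep rep0 xy])
        have "twisted k (\<lambda>i. b (skip j i)) (sgn_vec (drop_coordinate k j x)) =
            twisted k (coeffs w s t) (sgn_vec (drop_coordinate k j x))"
          by (rule twisted_cong) (simp_all add: co)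
        then show "twisted ?n b (sgn_vec x) = twisted ?n ?b0 (sgn_vec y)"
          unfolding key[OF w s t xy eq] twisted_drop[where b = b, OF j bj] by simp
      qed
    qed
  next
    assume "\<exists>h\<in>carrier ?H. \<forall>x\<in>?X. \<forall>y\<in>?X. ?\<theta> y = act h (?\<theta> x) \<longrightarrow> A x = A0 y"
    then obtain h where h: "h \<in> carrier ?H"
      and eq: "\<And>x y. x \<in> ?X \<Longrightarrow> y \<in> ?X \<Longrightarrow> ?\<theta> y = act h (?\<theta> x) \<Longrightarrow> A x = A0 y"
      by (elim bexE) simp
    obtain w s t where w: "w \<in> carrier (F2_vec k)" and s: "s \<in> Bij {0..k}" and t: "t \<in> carrier C2"
      and hws: "h = ((f2_coset k w, s), t)"
      using h by (auto simp: C2_semidirect_Sym_carrier F2_quot_carrier)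
    \<comment> \<open>The moved coefficients put back at the indices other than \<open>j\<close>,
      with 0 at \<open>j\<close>; this shows both that the labeling is magic-faced and that
      \<open>j\<close> is its direction.\<close>
    define b where "b l = (if l = j then 0 else coeffs w s t (inv_into {0..k} (skip j) l))" for l
    have bj: "b j = 0" by (simp add: b_def)
    have bs: "b (skip j i) = coeffs w s t i" if "i \<in> {0..k}" for i
      using bij_betw_inv_into_left[OF skip_bij[OF j] that] by (simp add: b_def skip_def)
    have "represents ?n b A"
      unfolding represents_def
    proof
      fix x assume x: "x \<in> ?X"
      have "?\<theta> x \<in> ?Y" using bij_betwE[OF bij_betw_split_position[OF j]] x by blast
      then have "act h (?\<theta> x) \<in> ?Y"
        using h by (auto simp: act_def intro!: affine_act_closed) (auto simp: C2_carrier)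
      then obtain y where y: "y \<in> ?X" "?\<theta> y = act h (?\<theta> x)"
        using bij_betw_imp_surj_on[OF bij_betw_split_position[OF j]] by (metis (no_types, lifting) imageE)
      then have Ay: "A x = A0 y" using eq x by blast
      have "twisted ?n b (sgn_vec x) =
          sgn_vec x j * twisted k (coeffs w s t) (sgn_vec (drop_coordinate k j x))"
        unfolding twisted_drop[where b = b, OF j bj] using bs
        by (metis (no_types, lifting) twisted_cong)
      then show "2 * real (A x) - (2 ^ ?n + 1) = twisted ?n b (sgn_vec x)"
        using rep0 y(1) key[OF w s t x y(1) y(2)[unfolded hws]] Ay by (simp add: represents_def)
    qed
    then show "A \<in> M"
      using A represented_magic[OF A] distinguished_direction_iff[OF _ j] bj by (simp add: M_def)
  qed
  have sub: "M \<subseteq> labelings ?n" by (auto simp: M_def magic_faced_def)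
  have H: "group ?H" by (rule DirProd_group[OF group_C2_semidirect_Sym]) simp
  have "act h y \<in> ?Y" if "h \<in> carrier ?H" "y \<in> ?Y" for h y
    using that by (auto simp: act_def intro!: affine_act_closed) (auto simp: C2_carrier)
  moreover have "act \<one>\<^bsub>?H\<^esub> y = y" if "y \<in> ?Y" for y
    using that by (auto simp: act_def affine_act_one C2_carrier)
  moreover have "act (h \<otimes>\<^bsub>?H\<^esub> h') y = act h (act h' y)"
    if "h \<in> carrier ?H" "h' \<in> carrier ?H" "y \<in> ?Y" for h h' y
    using that C2.m_assoc by (auto simp del: mult_integer_mod_group simp: act_def affine_act_mult)
  moreover have "h = \<one>\<^bsub>?H\<^esub>" if h: "h \<in> carrier ?H" and fix_all: "\<And>y. y \<in> ?Y \<Longrightarrow> act h y = y" for h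
  proof -
    have "affine_act k (fst h) a = a" if "a \<in> carrier (F2_quot k)" for a
      using fix_all[of "(a, 0)"] that by (simp add: act_def C2_carrier)
    then have "fst h = \<one>\<^bsub>C2_semidirect_Sym k\<^esub>"
      using h by (intro affine_act_faithful[OF k]) auto
    moreover have "snd h = 0"
      using h fix_all[of "(\<one>\<^bsub>F2_quot k\<^esub>, 0)"] by (auto simp: act_def C2_carrier)
    ultimately show ?thesis by (simp add: prod_eq_iff)
  qed
  ultimately show ?thesis
    using orbit_of_transported_action[OF H bij_betw_split_position[OF j] _ _ _ _ A0 sub M] by blast
qed

text \<open>Distinguished directions are the positive indices with zero coefficient. The
  classification leaves exactly one zero, which for odd \<open>n\<close> is not at index 0.\<close>

lemma odd_unique_direction:
  assumes n: "odd n" and A: "A \<in> magic_faced n"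
  shows "\<exists>!j. j \<in> {1..n} \<and> distinguished_direction n j A"
proof -
  obtain b where rep: "represents n b A" using magic_represented[OF A] by blast
  have "A \<in> labelings n" using A by (simp add: magic_faced_def)
  then obtain j where j: "j \<in> {0..n}" "b j = 0" "j \<noteq> 0"
    and bij: "bij_betw (\<lambda>i. \<bar>b i\<bar>) ({0..n} - {j}) ((\<lambda>r. 2 ^ r) ` {..<n})"
    using represents_classification[OF _ rep] n by blast
  have zero: "i = j" if "i \<in> {0..n}" "b i = 0" for i
  proof (rule ccontr)
    assume "i \<noteq> j"
    then have "\<bar>b i\<bar> \<in> (\<lambda>r. 2 ^ r) ` {..<n}" using bij_betwE[OF bij] that(1) by blast
    then show False using that(2) by auto
  qed
  show ?thesis
  proof (rule ex1I[of _ j])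
    show "j \<in> {1..n} \<and> distinguished_direction n j A"
      using j distinguished_direction_iff[OF rep] by auto
    fix i assume "i \<in> {1..n} \<and> distinguished_direction n i A"
    then show "i = j" using zero distinguished_direction_iff[OF rep] by auto
  qed
qed

section \<open>Counting and the final statement\<close>

lemma card_magic_even: "even n \<Longrightarrow> card (magic_faced n) = 2 ^ n * fact (n + 1)"
  using even_orbit card_C2_semidirect_Sym by simp

text \<open>Uniqueness of the direction partitions the labelings into \<open>n\<close> classes, each
  as large as its group, of order \<open>2 * (2 ^ (n - 1) * fact n)\<close>.\<close>

lemma card_magic_odd:
  assumes n: "odd n"
  shows "card (magic_faced n) = n * 2 ^ n * fact n"
proof -
  define D where "D j = {A \<in> magic_faced n. distinguished_direction n j A}" for j
  obtain k where k: "n = Suc k" "even k" using n by (cases n) auto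
  have D: "card (D j) = 2 ^ n * fact n" if "j \<in> {1..n}" for j
    using odd_orbit[of k j] that k card_C2_semidirect_Sym[of k]
    by (simp add: D_def card_cartesian_product C2_carrier)
  have "\<exists>j\<in>{1..n}. distinguished_direction n j A" if "A \<in> magic_faced n" for A
    using odd_unique_direction[OF n that] by blast
  then have "magic_faced n = (\<Union>j\<in>{1..n}. D j)" unfolding D_def by blast
  moreover have "card (\<Union>j\<in>{1..n}. D j) = (\<Sum>j\<in>{1..n}. card (D j))"
  proof (rule card_UN_disjoint)
    show "\<forall>j\<in>{1..n}. finite (D j)" using D by (auto intro: card_ge_0_finite)
    show "\<forall>i\<in>{1..n}. \<forall>j\<in>{1..n}. i \<noteq> j \<longrightarrow> D i \<inter> D j = {}"
      using odd_unique_direction[OF n] unfolding D_def by blast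
  qed simp
  ultimately show ?thesis by (simp add: D)
qed

theorem theorem1:
  fixes n :: nat
  shows "magic_faced n \<noteq> {}
    \<and> (even n \<longrightarrow>
         (\<exists>G. subgroup G (BijGroup (positions n))
            \<and> (BijGroup (positions n))\<lparr>carrier := G\<rparr> \<cong> C2_semidirect_Sym n
            \<and> single_orbit n G (magic_faced n)))
    \<and> (odd n \<longrightarrow>
         (\<forall>A \<in> magic_faced n. \<exists>!j. j \<in> {1..n} \<and> distinguished_direction n j A)
         \<and> (\<forall>j \<in> {1..n}.
              \<exists>G. subgroup G (BijGroup (positions n))
                \<and> (BijGroup (positions n))\<lparr>carrier := G\<rparr> \<cong> C2_semidirect_Sym (n - 1) \<times>\<times> C2
                \<and> single_orbit n G {A \<in> magic_faced n. distinguished_direction n j A}))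
    \<and> (even n \<longrightarrow> card (magic_faced n) = 2 ^ n * fact (n + 1))
    \<and> (odd n \<longrightarrow> card (magic_faced n) = n * 2 ^ n * fact n)"
proof (intro conjI impI ballI)
  \<comment> \<open>Existence is read off from the positive count.\<close>
  have "card (magic_faced n) \<noteq> 0"
  proof (cases "even n")
    case False
    then have "n \<noteq> 0" by (intro notI) simp
    then show ?thesis using card_magic_odd[OF False] by simp
  qed (simp add: card_magic_even)
  then show "magic_faced n \<noteq> {}" by force
next
  assume n: "even n"
  show "\<exists>G. subgroup G (BijGroup (positions n))
      \<and> (BijGroup (positions n))\<lparr>carrier := G\<rparr> \<cong> C2_semidirect_Sym n
      \<and> single_orbit n G (magic_faced n)"
    using even_orbit[OF n] by blast
next
  fix A assume "odd n" "A \<in> magic_faced n"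
  then show "\<exists>!j. j \<in> {1..n} \<and> distinguished_direction n j A" by (rule odd_unique_direction)
next
  fix j assume "odd n" and j: "j \<in> {1..n}"
  then obtain k where k: "n = Suc k" "even k" by (cases n) auto
  have "n - 1 = k" using k by simp
  then show "\<exists>G. subgroup G (BijGroup (positions n))
      \<and> (BijGroup (positions n))\<lparr>carrier := G\<rparr> \<cong> C2_semidirect_Sym (n - 1) \<times>\<times> C2
      \<and> single_orbit n G {A \<in> magic_faced n. distinguished_direction n j A}"
    using odd_orbit[OF k(2), of j] j unfolding k(1) by simp
next
  assume "even n"
  then show "card (magic_faced n) = 2 ^ n * fact (n + 1)" by (rule card_magic_even)
next
  assume "odd n"
  then show "card (magic_faced n) = n * 2 ^ n * fact n" by (rule card_magic_odd)
qed

end
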